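(* Let $\rho=\rho_g(\mathbf{l},\mathbf{m};S)$ be an $n$-mode Gaussian state in $\Gamma(\mathbb{C}^n)$, let $N$ be the total number operator in $\Gamma(\mathbb{C}^n)$, and let $\langle X\rangle$ denote the expectation of an observable $X$ in the state $\rho$. Then: (i) For all $\mathbf{x},\mathbf{y}\in\mathbb{R}^n$, $$\left\langle W(\mathbf{x}+i\mathbf{y})^\dagger N\,W(\mathbf{x}+i\mathbf{y})\right\rangle-\langle N\rangle=\|\mathbf{x}\|^2+\|\mathbf{y}\|^2+\sqrt2\,(\mathbf{y}^T\mathbf{l}+\mathbf{x}^T\mathbf{m}).$$ (ii) For every $L\in Sp(2n)$, $$\left\langle\Gamma(L)^\dagger N\,\Gamma(L)\right\rangle-\langle N\rangle=\frac12\left[\mathrm{Tr}\,S\left(L^{-1}(L^{-1})^T-I_{2n}\right)+\begin{pmatrix}\mathbf{l}\\ -\mathbf{m}\end{pmatrix}^T\left(L^{-1}(L^{-1})^T-I_{2n}\right)\begin{pmatrix}\mathbf{l}\\ -\mathbf{m}\end{pmatrix}\right].$$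
   Context: $\Gamma(\mathbb{C}^n)=\bigoplus_{r\ge0}(\mathbb{C}^n)^{\circledS r}$ is the boson (symmetric) Fock space over $\mathbb{C}^n$ (inner products are linear in the second variable). For $\mathbf{u}\in\mathbb{C}^n$ the exponential vector is $\mathbf{e}(\mathbf{u})=\bigoplus_{r\ge0}\mathbf{u}^{\otimes r}/\sqrt{r!}$. The Weyl operator $W(\mathbf{u})$ is the unitary operator on $\Gamma(\mathbb{C}^n)$ determined by $W(\mathbf{u})\mathbf{e}(\mathbf{v})=e^{-\frac12\|\mathbf{u}\|^2-\langle\mathbf{u}|\mathbf{v}\rangle}\mathbf{e}(\mathbf{u}+\mathbf{v})$ for all $\mathbf{v}\in\mathbb{C}^n$. A state is a positive operator of trace one. The $n$-mode Gaussian state $\rho_g(\mathbf{l},\mathbf{m};S)$, with $\mathbf{l},\mathbf{m}\in\mathbb{R}^n$ and $S$ a real symmetric $2n\times2n$ matrix satisfying $2S+iJ_{2n}\ge0$, $J_{2n}=\begin{bmatrix} 0 & -I_n \\ I_n & 0 \end{bmatrix}$, is the unique state $\rho$ with $$\mathrm{Tr}\,\rho W(\mathbf{x}+i\mathbf{y})=\exp\left[-i\sqrt2(\mathbf{l}^T\mathbf{x}-\mathbf{m}^T\mathbf{y})-\begin{pmatrix}\mathbf{x}\\ \mathbf{y}\end{pmatrix}^TS\begin{pmatrix}\mathbf{x}\\ \mathbf{y}\end{pmatrix}\right],\quad\mathbf{x},\mathbf{y}\in\mathbb{R}^n.$$ The total number operator $N$ is the self-adjoint operator acting as multiplication by $r$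 on the $r$-particle subspace $(\mathbb{C}^n)^{\circledS r}$, $r=0,1,2,\dots$. For a unitary $V$, $\langle V^\dagger NV\rangle=\sum_{k\ge0}k\,\mathrm{Tr}(\rho V^\dagger P_kV)$ with $P_k$ the projection onto the $k$-particle subspace. $Sp(2n)$ is the group of real $2n\times2n$ matrices $L$ with $L^TJ_{2n}L=J_{2n}$. For $L\in Sp(2n)$, $\Gamma(L)$ is the unitary operator on $\Gamma(\mathbb{C}^n)$, unique up to a scalar of modulus one, with $\Gamma(L)W(\mathbf{x}+i\mathbf{y})\Gamma(L)^{-1}=W(\mathbf{x}'+i\mathbf{y}')$ for all $\mathbf{x},\mathbf{y}\in\mathbb{R}^n$, where $\begin{pmatrix}\mathbf{x}'\\ \mathbf{y}'\end{pmatrix}=L\begin{pmatrix}\mathbf{x}\\ \mathbf{y}\end{pmatrix}$. *)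

theory Defs
  imports "HOL-Analysis.Analysis"
begin

section \<open>The boson Fock space over \<open>\<complex>\<^sup>n\<close>\<close>

text \<open>
  The \<open>r\<close>-fold tensor power of \<open>\<complex>\<^sup>n\<close> is the space of functions on \<open>r\<close>-tuples of indices, i.e. on
  lists of length \<open>r\<close> over \<^typ>\<open>'n\<close>; the value at \<open>xs\<close> is the coordinate with respect to
  \<open>e\<^bsub>xs!0\<^esub> \<otimes> \<dots> \<otimes> e\<^bsub>xs!(r-1)\<^esub>\<close>.  The Hilbert space direct sum over all \<open>r\<close> therefore consists of the
  square-summable functions on \<^typ>\<open>'n list\<close>, and the symmetric tensors are those functions that
  are invariant under permutations of the list.
\<close>

typedef 'n fock = "{f :: 'n list \<Rightarrow> complex.
    (\<forall>xs ys. mset xs = mset ys \<longrightarrow> f xs = f ys) \<and> (\<lambda>xs. (cmod (f xs))\<^sup>2) summable_on UNIV}"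
  morphisms amp Abs_fock
  by (rule exI[of _ "\<lambda>_. 0"]) simp

setup_lifting type_definition_fock

lemma amp_perm: "mset xs = mset ys \<Longrightarrow> amp f xs = amp f ys"
  using amp[of f] by blast

lemma amp_summable: "(\<lambda>xs. (cmod (amp f xs))\<^sup>2) summable_on UNIV"
  using amp[of f] by blast

lemma square_summable_add:
  fixes f g :: "'a \<Rightarrow> complex"
  assumes "(\<lambda>x. (cmod (f x))\<^sup>2) summable_on A" "(\<lambda>x. (cmod (g x))\<^sup>2) summable_on A"
  shows "(\<lambda>x. (cmod (f x + g x))\<^sup>2) summable_on A"
proof (rule summable_on_comparison_test)
  show "(\<lambda>x. 2 * (cmod (f x))\<^sup>2 + 2 * (cmod (g x))\<^sup>2) summable_on A"
    by (intro summable_on_add summable_on_cmult_right assms)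
  fix x
  have "(cmod (f x + g x))\<^sup>2 \<le> (cmod (f x) + cmod (g x))\<^sup>2"
    by (intro power_mono norm_triangle_ineq) auto
  also have "\<dots> \<le> 2 * (cmod (f x))\<^sup>2 + 2 * (cmod (g x))\<^sup>2"
    using sum_squares_bound[of "cmod (f x)" "cmod (g x)"] by (simp add: power2_sum)
  finally show "(cmod (f x + g x))\<^sup>2 \<le> 2 * (cmod (f x))\<^sup>2 + 2 * (cmod (g x))\<^sup>2" .
qed auto

lemma square_summable_scale:
  fixes f :: "'a \<Rightarrow> complex"
  assumes "(\<lambda>x. (cmod (f x))\<^sup>2) summable_on A"
  shows "(\<lambda>x. (cmod (c * f x))\<^sup>2) summable_on A"
  using summable_on_cmult_right[OF assms, of "(cmod c)\<^sup>2"]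
  by (simp add: norm_mult power_mult_distrib)

lift_definition fock_scale :: "complex \<Rightarrow> 'n fock \<Rightarrow> 'n fock"  (infixr \<open>*\<^sub>C\<close> 75)
  is "\<lambda>c f xs. c * f xs"
proof -
  fix c :: complex and f :: "'n list \<Rightarrow> complex"
  assume f: "(\<forall>xs ys. mset xs = mset ys \<longrightarrow> f xs = f ys) \<and> (\<lambda>xs. (cmod (f xs))\<^sup>2) summable_on UNIV"
  have "(\<lambda>xs. (cmod (c * f xs))\<^sup>2) summable_on UNIV"
    using f by (intro square_summable_scale) blast
  moreover have "c * f xs = c * f ys" if "mset xs = mset ys" for xs ys
    using f[THEN conjunct1, rule_format, OF that] by simp
  ultimately show "(\<forall>xs ys. mset xs = mset ys \<longrightarrow> c * f xs = c * f ys) \<and>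
      (\<lambda>xs. (cmod (c * f xs))\<^sup>2) summable_on UNIV"
    by blast
qed

definition cinner :: "'n fock \<Rightarrow> 'n fock \<Rightarrow> complex" where
  "cinner f g = (\<Sum>\<^sub>\<infinity>xs. cnj (amp f xs) * amp g xs)"

lemma Re_cnj_mult_self: "Re (cnj z * z) = (cmod z)\<^sup>2"
  unfolding cmod_power2 by (simp add: power2_eq_square)

lemma cinner_summable: "(\<lambda>xs. cnj (amp f xs) * amp g xs) summable_on UNIV"
proof (rule abs_summable_summable, rule abs_summable_product)
  show "(\<lambda>xs. norm (cnj (amp f xs) * cnj (amp f xs))) summable_on UNIV"
    using amp_summable[of f] by (simp add: norm_mult power2_eq_square)
  show "(\<lambda>xs. norm (amp g xs * amp g xs)) summable_on UNIV"
    using amp_summable[of g] by (simp add: norm_mult power2_eq_square)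
qed

instantiation fock :: (type) real_inner
begin

lift_definition zero_fock :: "'a fock" is "\<lambda>_. 0" by simp

lift_definition plus_fock :: "'a fock \<Rightarrow> 'a fock \<Rightarrow> 'a fock" is "\<lambda>f g xs. f xs + g xs"
proof -
  fix f g :: "'a list \<Rightarrow> complex"
  assume f: "(\<forall>xs ys. mset xs = mset ys \<longrightarrow> f xs = f ys) \<and> (\<lambda>xs. (cmod (f xs))\<^sup>2) summable_on UNIV"
    and g: "(\<forall>xs ys. mset xs = mset ys \<longrightarrow> g xs = g ys) \<and> (\<lambda>xs. (cmod (g xs))\<^sup>2) summable_on UNIV"
  have "(\<lambda>xs. (cmod (f xs + g xs))\<^sup>2) summable_on UNIV"
    by (rule square_summable_add) (use f g in blast)+
  moreover have "f xs + g xs = f ys + g ys" if "mset xs = mset ys" for xs ys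
    using f[THEN conjunct1, rule_format, OF that] g[THEN conjunct1, rule_format, OF that] by simp
  ultimately show "(\<forall>xs ys. mset xs = mset ys \<longrightarrow> f xs + g xs = f ys + g ys) \<and>
      (\<lambda>xs. (cmod (f xs + g xs))\<^sup>2) summable_on UNIV"
    by blast
qed

definition uminus_fock :: "'a fock \<Rightarrow> 'a fock" where "- f = (-1) *\<^sub>C f"
definition minus_fock :: "'a fock \<Rightarrow> 'a fock \<Rightarrow> 'a fock" where "f - g = f + - (g :: 'a fock)"
definition scaleR_fock :: "real \<Rightarrow> 'a fock \<Rightarrow> 'a fock" where "r *\<^sub>R f = complex_of_real r *\<^sub>C f"
definition inner_fock :: "'a fock \<Rightarrow> 'a fock \<Rightarrow> real" where "f \<bullet> g = Re (cinner f g)"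
definition norm_fock :: "'a fock \<Rightarrow> real" where "norm (f :: 'a fock) = sqrt (f \<bullet> f)"
definition dist_fock :: "'a fock \<Rightarrow> 'a fock \<Rightarrow> real" where "dist (f :: 'a fock) g = norm (f - g)"
definition sgn_fock :: "'a fock \<Rightarrow> 'a fock" where "sgn (f :: 'a fock) = inverse (norm f) *\<^sub>R f"
definition uniformity_fock :: "('a fock \<times> 'a fock) filter" where
  "uniformity_fock = (INF e\<in>{0<..}. principal {(f :: 'a fock, g). dist f g < e})"
definition open_fock :: "'a fock set \<Rightarrow> bool" where
  "open_fock U \<longleftrightarrow> (\<forall>f\<in>U. eventually (\<lambda>(f', g). f' = f \<longrightarrow> g \<in> U) uniformity)"

instance
proof
  fix f g h :: "'a fock" and r s :: real and U :: "'a fock set"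
  note ext = amp_inject[THEN iffD1, OF ext]
  show "f + g + h = f + (g + h)" "f + g = g + f" "0 + f = f" "- f + f = 0"
    by (rule ext; simp add: plus_fock.rep_eq zero_fock.rep_eq uminus_fock_def fock_scale.rep_eq)+
  show "f - g = f + - g" by (rule minus_fock_def)
  show "r *\<^sub>R (f + g) = r *\<^sub>R f + r *\<^sub>R g" "(r + s) *\<^sub>R f = r *\<^sub>R f + s *\<^sub>R f"
    "r *\<^sub>R s *\<^sub>R f = (r * s) *\<^sub>R f" "1 *\<^sub>R f = f"
    by (rule ext; simp add: plus_fock.rep_eq scaleR_fock_def fock_scale.rep_eq algebra_simps)+
  show "sgn f = inverse (norm f) *\<^sub>R f" by (rule sgn_fock_def)
  show "dist f g = norm (f - g)" by (rule dist_fock_def)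
  show "uniformity = (INF e\<in>{0<..}. principal {(f :: 'a fock, g). dist f g < e})"
    by (rule uniformity_fock_def)
  show "open U \<longleftrightarrow> (\<forall>f\<in>U. eventually (\<lambda>(f', g). f' = f \<longrightarrow> g \<in> U) uniformity)"
    by (rule open_fock_def)
  show "norm f = sqrt (f \<bullet> f)" by (rule norm_fock_def)
  have "cinner g f = cnj (cinner f g)"
    unfolding cinner_def infsum_cnj[symmetric] complex_cnj_mult complex_cnj_cnj
    by (simp only: mult.commute)
  then show "f \<bullet> g = g \<bullet> f" by (simp add: inner_fock_def)
  have "cinner (f + g) h = cinner f h + cinner g h"
    by (simp add: cinner_def plus_fock.rep_eq distrib_right infsum_add cinner_summable)
  then show "(f + g) \<bullet> h = f \<bullet> h + g \<bullet> h" by (simp add: inner_fock_def)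
  have "cinner (r *\<^sub>R f) g = r * cinner f g"
    by (simp add: cinner_def scaleR_fock_def fock_scale.rep_eq mult.assoc infsum_cmult_right')
  then show "(r *\<^sub>R f) \<bullet> g = r * (f \<bullet> g)" by (simp add: inner_fock_def)
  have sq: "f \<bullet> f = (\<Sum>\<^sub>\<infinity>xs. (cmod (amp f xs))\<^sup>2)"
    unfolding inner_fock_def cinner_def
    by (subst infsum_Re[symmetric, OF cinner_summable])
       (simp only: Re_cnj_mult_self)
  show "0 \<le> f \<bullet> f" unfolding sq by (intro infsum_nonneg) auto
  show "f \<bullet> f = 0 \<longleftrightarrow> f = 0"
  proof
    assume "f \<bullet> f = 0"
    then have "(cmod (amp f xs))\<^sup>2 = 0" for xs
      using nonneg_infsum_le_0D[OF _ amp_summable, of f xs] sq by auto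
    then show "f = 0" by (intro ext) (simp add: zero_fock.rep_eq)
  next
    assume "f = 0"
    then show "f \<bullet> f = 0" unfolding sq by (simp add: zero_fock.rep_eq)
  qed
qed

end

lemma norm_fock_sq: "(norm f)\<^sup>2 = (\<Sum>\<^sub>\<infinity>xs. (cmod (amp f xs))\<^sup>2)"
proof -
  have "(norm f)\<^sup>2 = f \<bullet> f" by (simp add: power2_norm_eq_inner)
  also have "\<dots> = (\<Sum>\<^sub>\<infinity>xs. (cmod (amp f xs))\<^sup>2)"
    unfolding inner_fock_def cinner_def
    by (subst infsum_Re[symmetric, OF cinner_summable])
       (simp only: Re_cnj_mult_self)
  finally show ?thesis .
qed

lemma amp_diff: "amp (f - g) xs = amp f xs - amp g xs"
  by (simp add: minus_fock_def uminus_fock_def plus_fock.rep_eq fock_scale.rep_eq)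

lemma sum_amp_le: "finite F \<Longrightarrow> (\<Sum>xs\<in>F. (cmod (amp f xs))\<^sup>2) \<le> (norm f)\<^sup>2"
  unfolding norm_fock_sq by (intro finite_sum_le_infsum amp_summable) auto

lemma norm_amp_le: "cmod (amp f xs) \<le> norm f"
  by (rule power2_le_imp_le) (use sum_amp_le[of "{xs}" f] in simp_all)

instance fock :: (type) complete_space
proof
  fix X :: "nat \<Rightarrow> 'a fock"
  assume C: "Cauchy X"
  have "Cauchy (\<lambda>n. amp (X n) xs)" for xs
  proof (rule metric_CauchyI)
    fix e :: real assume "e > 0"
    then obtain M where M: "\<And>m n. m \<ge> M \<Longrightarrow> n \<ge> M \<Longrightarrow> dist (X m) (X n) < e"
      using C by (meson metric_CauchyD)
    have "dist (amp (X m) xs) (amp (X n) xs) \<le> dist (X m) (X n)" for m n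
      using norm_amp_le[of "X m - X n" xs] by (simp add: dist_norm amp_diff)
    then show "\<exists>M. \<forall>m\<ge>M. \<forall>n\<ge>M. dist (amp (X m) xs) (amp (X n) xs) < e"
      using M by (meson le_less_trans)
  qed
  then have "\<forall>xs. \<exists>l. (\<lambda>n. amp (X n) xs) \<longlonglongrightarrow> l"
    using Cauchy_convergent convergent_def by blast
  then obtain g where g: "\<And>xs. (\<lambda>n. amp (X n) xs) \<longlonglongrightarrow> g xs" by metis
  have perm: "g xs = g ys" if "mset xs = mset ys" for xs ys
    using g[of xs] g[of ys] amp_perm[OF that] LIMSEQ_unique by auto
  have tail: "\<exists>M. \<forall>n\<ge>M. \<forall>F. finite F \<longrightarrow> (\<Sum>xs\<in>F. (cmod (amp (X n) xs - g xs))\<^sup>2) \<le> e\<^sup>2"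
    if "e > 0" for e :: real
  proof -
    obtain M where M: "\<And>m n. m \<ge> M \<Longrightarrow> n \<ge> M \<Longrightarrow> dist (X m) (X n) < e"
      using C \<open>e > 0\<close> by (meson metric_CauchyD)
    have "(\<Sum>xs\<in>F. (cmod (amp (X n) xs - g xs))\<^sup>2) \<le> e\<^sup>2" if n: "n \<ge> M" and F: "finite F" for n F
    proof (rule tendsto_upperbound)
      show "(\<lambda>m. \<Sum>xs\<in>F. (cmod (amp (X n) xs - amp (X m) xs))\<^sup>2)
          \<longlonglongrightarrow> (\<Sum>xs\<in>F. (cmod (amp (X n) xs - g xs))\<^sup>2)"
        by (intro tendsto_intros g)
      show "\<forall>\<^sub>F m in sequentially. (\<Sum>xs\<in>F. (cmod (amp (X n) xs - amp (X m) xs))\<^sup>2) \<le> e\<^sup>2"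
      proof (rule eventually_sequentiallyI)
        fix m assume "m \<ge> M"
        then have "norm (X n - X m) \<le> e" using M[OF n] by (simp add: dist_norm less_imp_le)
        then have "(norm (X n - X m))\<^sup>2 \<le> e\<^sup>2" by (simp add: power_mono)
        then show "(\<Sum>xs\<in>F. (cmod (amp (X n) xs - amp (X m) xs))\<^sup>2) \<le> e\<^sup>2"
          using sum_amp_le[OF F, of "X n - X m"] by (simp add: amp_diff)
      qed
    qed simp
    then show ?thesis by blast
  qed
  have diff_summable: "(\<lambda>xs. (cmod (amp (X n) xs - g xs))\<^sup>2) summable_on UNIV"
    if "\<And>F. finite F \<Longrightarrow> (\<Sum>xs\<in>F. (cmod (amp (X n) xs - g xs))\<^sup>2) \<le> B" for n B
    by (rule nonneg_bdd_above_summable_on, simp, rule bdd_aboveI[of _ B]) (use that in auto)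
  obtain M where M: "\<forall>n\<ge>M. \<forall>F. finite F \<longrightarrow> (\<Sum>xs\<in>F. (cmod (amp (X n) xs - g xs))\<^sup>2) \<le> 1\<^sup>2"
    using tail[of 1] by auto
  have "(\<lambda>xs. (cmod (amp (X M) xs - g xs))\<^sup>2) summable_on UNIV"
    by (rule diff_summable[of _ "1\<^sup>2"]) (use M in blast)
  then have "(\<lambda>xs. (cmod (amp (X M) xs + (-1) * (amp (X M) xs - g xs)))\<^sup>2) summable_on UNIV"
    by (intro square_summable_add square_summable_scale amp_summable)
  then have "(\<lambda>xs. (cmod (g xs))\<^sup>2) summable_on UNIV" by simp
  then have amp_g: "amp (Abs_fock g) = g"
    using perm by (intro Abs_fock_inverse) blast
  have "X \<longlonglongrightarrow> Abs_fock g"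
  proof (rule metric_LIMSEQ_I)
    fix e :: real assume "e > 0"
    then obtain M where M: "\<forall>n\<ge>M. \<forall>F. finite F \<longrightarrow>
        (\<Sum>xs\<in>F. (cmod (amp (X n) xs - g xs))\<^sup>2) \<le> (e/2)\<^sup>2"
      using tail[of "e/2"] by auto
    have "dist (X n) (Abs_fock g) < e" if "n \<ge> M" for n
    proof -
      have "(norm (X n - Abs_fock g))\<^sup>2 \<le> (e/2)\<^sup>2"
        unfolding norm_fock_sq amp_diff amp_g
        by (rule infsum_le_finite_sums[OF diff_summable[of _ "(e/2)\<^sup>2"]]) (use M that in blast)+
      then have "norm (X n - Abs_fock g) \<le> e/2"
        by (rule power2_le_imp_le) (use \<open>e > 0\<close> in simp)
      then show ?thesis using \<open>e > 0\<close> by (simp add: dist_norm)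
    qed
    then show "\<exists>M. \<forall>n\<ge>M. dist (X n) (Abs_fock g) < e" by blast
  qed
  then show "convergent X" unfolding convergent_def by blast
qed

section \<open>Exponential vectors and number projections\<close>

lemma finite_lists_length: "finite {xs :: 'n::finite list. length xs = r}"
  using finite_lists_length_eq[of "UNIV :: 'n set" r] by simp

lemma sum_prod_list_length:
  fixes h :: "'n::finite \<Rightarrow> real"
  shows "(\<Sum>xs | length xs = r. prod_list (map h xs)) = (\<Sum>i\<in>UNIV. h i) ^ r"
proof (induction r)
  case (Suc r)
  have eq: "{xs :: 'n list. length xs = Suc r} = (\<lambda>(i, xs). i # xs) ` (UNIV \<times> {xs. length xs = r})"
    by (auto simp: length_Suc_conv image_iff)
  have "(\<Sum>xs | length xs = Suc r. prod_list (map h xs))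
      = (\<Sum>(i, xs)\<in>UNIV \<times> {xs. length xs = r}. h i * prod_list (map h xs))"
    unfolding eq by (subst sum.reindex) (auto simp: inj_on_def case_prod_beta)
  also have "\<dots> = (\<Sum>i\<in>UNIV. h i) * (\<Sum>xs | length xs = r. prod_list (map h xs))"
    by (simp add: sum_product sum.cartesian_product)
  finally show ?case using Suc.IH by simp
qed simp

text \<open>
  The coordinates of \<open>\<^bold>u\<^sup>\<otimes>\<^sup>r / \<surd>r!\<close> are the products of the coordinates of \<open>\<^bold>u\<close> along the index tuple,
  divided by \<open>\<surd>r!\<close>.
\<close>

lift_definition expvec :: "complex ^ 'n \<Rightarrow> 'n fock"
  is "\<lambda>u xs. prod_list (map (($) u) xs) / complex_of_real (sqrt (fact (length xs)))"
proof
  fix u :: "complex ^ 'n"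
  let ?f = "\<lambda>xs. prod_list (map (($) u) xs) / complex_of_real (sqrt (fact (length xs)))"
  have "?f xs = ?f ys" if "mset xs = mset ys" for xs ys
  proof -
    have "prod_list (map (($) u) xs) = prod_list (map (($) u) ys)"
      using that by (metis mset_map prod_mset_prod_list)
    moreover have "length xs = length ys" using that by (rule mset_eq_length)
    ultimately show ?thesis by simp
  qed
  then show "\<forall>xs ys. mset xs = mset ys \<longrightarrow> ?f xs = ?f ys" by blast
  let ?h = "\<lambda>i. (cmod (u $ i))\<^sup>2"
  let ?s = "\<Sum>i\<in>UNIV. ?h i"
  have cm: "(cmod (prod_list (map (($) u) xs)))\<^sup>2 = prod_list (map ?h xs)" for xs
    by (induction xs) (auto simp: norm_mult power_mult_distrib)
  have sq: "(cmod (?f xs))\<^sup>2 = prod_list (map ?h xs) / fact (length xs)" for xs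
    by (simp add: norm_divide power_divide cm)
  have bound: "sum (\<lambda>xs. (cmod (?f xs))\<^sup>2) F \<le> exp ?s" if "finite F" for F
  proof -
    define R where "R = Suc (Max (insert 0 (length ` F)))"
    have "F \<subseteq> (\<Union>r\<in>{..<R}. {xs. length xs = r})"
      using that by (auto simp: R_def less_Suc_eq_le intro!: Max_ge)
    then have "sum (\<lambda>xs. (cmod (?f xs))\<^sup>2) F
        \<le> sum (\<lambda>xs. (cmod (?f xs))\<^sup>2) (\<Union>r\<in>{..<R}. {xs. length xs = r})"
      by (intro sum_mono2) (auto simp: finite_lists_length)
    also have "\<dots> = (\<Sum>r<R. \<Sum>xs | length xs = r. (cmod (?f xs))\<^sup>2)"
      by (rule sum.UNION_disjoint) (auto simp: finite_lists_length)
    also have "\<dots> = (\<Sum>r<R. (\<Sum>xs | length xs = r. prod_list (map ?h xs)) / fact r)"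
      unfolding sq sum_divide_distrib by (intro sum.cong refl) auto
    also have "\<dots> = (\<Sum>r<R. ?s ^ r /\<^sub>R fact r)"
      by (simp add: sum_prod_list_length divide_inverse mult.commute)
    also have "\<dots> \<le> exp ?s"
      unfolding exp_def
      by (intro sum_le_suminf summable_exp_generic) (auto simp: sum_nonneg)
    finally show ?thesis .
  qed
  show "(\<lambda>xs. (cmod (?f xs))\<^sup>2) summable_on UNIV"
    by (rule nonneg_bdd_above_summable_on, simp, rule bdd_aboveI[of _ "exp ?s"]) (use bound in blast)
qed

text \<open>The projection \<open>P\<^sub>k\<close> onto the \<open>k\<close>-particle subspace.\<close>

lift_definition number_proj :: "nat \<Rightarrow> 'n fock \<Rightarrow> 'n fock"
  is "\<lambda>k f xs. if length xs = k then f xs else 0"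
proof
  fix k and f :: "'n list \<Rightarrow> complex"
  let ?g = "\<lambda>xs. if length xs = k then f xs else 0"
  assume f: "(\<forall>xs ys. mset xs = mset ys \<longrightarrow> f xs = f ys) \<and> (\<lambda>xs. (cmod (f xs))\<^sup>2) summable_on UNIV"
  have "?g xs = ?g ys" if "mset xs = mset ys" for xs ys
    using f[THEN conjunct1, rule_format, OF that] mset_eq_length[OF that] by simp
  then show "\<forall>xs ys. mset xs = mset ys \<longrightarrow> ?g xs = ?g ys" by blast
  show "(\<lambda>xs. (cmod (?g xs))\<^sup>2) summable_on UNIV"
    by (rule summable_on_comparison_test[OF f[THEN conjunct2]]) simp_all
qed

section \<open>Operators, trace and states\<close>

definition cbounded_linear :: "('n fock \<Rightarrow> 'n fock) \<Rightarrow> bool" where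
  "cbounded_linear T \<longleftrightarrow> bounded_linear T \<and> (\<forall>c f. T (c *\<^sub>C f) = c *\<^sub>C T f)"

definition unitary_op :: "('n fock \<Rightarrow> 'n fock) \<Rightarrow> bool" where
  "unitary_op U \<longleftrightarrow> cbounded_linear U \<and> surj U \<and> (\<forall>f g. cinner (U f) (U g) = cinner f g)"

definition cadjoint :: "('n fock \<Rightarrow> 'n fock) \<Rightarrow> 'n fock \<Rightarrow> 'n fock" where
  "cadjoint T = (THE T'. \<forall>f g. cinner (T f) g = cinner f (T' g))"

definition positive_op :: "('n fock \<Rightarrow> 'n fock) \<Rightarrow> bool" where
  "positive_op T \<longleftrightarrow> cbounded_linear T \<and> (\<forall>f. cinner f (T f) \<in> \<real>\<^sub>\<ge>\<^sub>0)"

definition orthonormal_basis :: "'n fock set \<Rightarrow> bool" where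
  "orthonormal_basis B \<longleftrightarrow>
     (\<forall>b\<in>B. \<forall>b'\<in>B. cinner b b' = (if b = b' then 1 else 0)) \<and>
     (\<forall>f. (\<forall>b\<in>B. cinner b f = 0) \<longrightarrow> f = 0)"

text \<open>
  A bounded operator is of trace class iff its diagonal is (unconditionally) summable along every
  orthonormal basis, and then the sum does not depend on the basis.  The relation
  \<open>has_op_trace T t\<close> thus says that \<open>T\<close> is of trace class with trace \<open>t\<close>.
\<close>

definition has_op_trace :: "('n fock \<Rightarrow> 'n fock) \<Rightarrow> complex \<Rightarrow> bool" where
  "has_op_trace T t \<longleftrightarrow>
     cbounded_linear T \<and> (\<forall>B. orthonormal_basis B \<longrightarrow> ((\<lambda>b. cinner b (T b)) has_sum t) B)"

definition op_trace :: "('n fock \<Rightarrow> 'n fock) \<Rightarrow> complex" where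
  "op_trace T = (THE t. has_op_trace T t)"

definition state :: "('n fock \<Rightarrow> 'n fock) \<Rightarrow> bool" where
  "state \<rho> \<longleftrightarrow> positive_op \<rho> \<and> has_op_trace \<rho> 1"

section \<open>Weyl operators\<close>

definition cdot :: "complex ^ 'm \<Rightarrow> complex ^ 'm \<Rightarrow> complex" where
  "cdot u v = (\<Sum>i\<in>UNIV. cnj (u $ i) * v $ i)"

definition weyl :: "complex ^ 'n \<Rightarrow> 'n fock \<Rightarrow> 'n fock" where
  "weyl u = (THE W. unitary_op W \<and>
     (\<forall>v. W (expvec v) = exp (- (complex_of_real ((norm u)\<^sup>2) / 2) - cdot u v) *\<^sub>C expvec (u + v)))"

definition cvec :: "real ^ 'n \<Rightarrow> real ^ 'n \<Rightarrow> complex ^ 'n" where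
  "cvec x y = (\<chi> i. Complex (x $ i) (y $ i))"

section \<open>Symplectic matrices and Gaussian states\<close>

text \<open>\<open>2n \<times> 2n\<close> matrices are indexed by \<^typ>\<open>'n + 'n\<close>, with \<^const>\<open>Inl\<close> for the first block.\<close>

definition stack :: "real ^ 'n \<Rightarrow> real ^ 'n \<Rightarrow> real ^ ('n::finite + 'n)" where
  "stack x y = (\<chi> i. case i of Inl a \<Rightarrow> x $ a | Inr b \<Rightarrow> y $ b)"

definition upper :: "real ^ ('n::finite + 'n) \<Rightarrow> real ^ 'n" where "upper z = (\<chi> a. z $ Inl a)"
definition lower :: "real ^ ('n::finite + 'n) \<Rightarrow> real ^ 'n" where "lower z = (\<chi> b. z $ Inr b)"

definition J_mat :: "real ^ ('n::finite + 'n) ^ ('n + 'n)" where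
  "J_mat = (\<chi> i j. case (i, j) of
      (Inl a, Inr b) \<Rightarrow> (if a = b then -1 else 0)
    | (Inr a, Inl b) \<Rightarrow> (if a = b then 1 else 0)
    | _ \<Rightarrow> 0)"

definition Sp :: "(real ^ ('n::finite + 'n) ^ ('n + 'n)) set" where
  "Sp = {L. transpose L ** J_mat ** L = J_mat}"

definition psd :: "complex ^ 'm ^ 'm \<Rightarrow> bool" where
  "psd A \<longleftrightarrow> (\<forall>z. cdot z (A *v z) \<in> \<real>\<^sub>\<ge>\<^sub>0)"

definition gaussian_state ::
  "real ^ 'n \<Rightarrow> real ^ 'n \<Rightarrow> real ^ ('n::finite + 'n) ^ ('n + 'n) \<Rightarrow> ('n fock \<Rightarrow> 'n fock) \<Rightarrow> bool" where
  "gaussian_state l m S \<rho> \<longleftrightarrow>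
     transpose S = S \<and>
     psd (\<chi> i j. complex_of_real (2 * S $ i $ j) + \<i> * complex_of_real (J_mat $ i $ j)) \<and>
     state \<rho> \<and>
     (\<forall>x y. has_op_trace (\<rho> \<circ> weyl (cvec x y))
        (exp (- \<i> * complex_of_real (sqrt 2 * (l \<bullet> x - m \<bullet> y))
              - complex_of_real (stack x y \<bullet> (S *v stack x y)))))"

text \<open>
  \<open>\<Gamma>(L)\<close> is determined only up to a phase, so it is described by the relation \<open>G\<close> is a version
  of \<open>\<Gamma>(L)\<close>.
\<close>

definition is_Gamma :: "real ^ ('n::finite + 'n) ^ ('n + 'n) \<Rightarrow> ('n fock \<Rightarrow> 'n fock) \<Rightarrow> bool" where
  "is_Gamma L G \<longleftrightarrow> unitary_op G \<and>
     (\<forall>x y. G \<circ> weyl (cvec x y) \<circ> inv G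
        = weyl (cvec (upper (L *v stack x y)) (lower (L *v stack x y))))"

section \<open>Expectation of the total number operator\<close>

definition number_term :: "('n fock \<Rightarrow> 'n fock) \<Rightarrow> ('n fock \<Rightarrow> 'n fock) \<Rightarrow> nat \<Rightarrow> complex" where
  "number_term \<rho> V k = of_nat k * op_trace (\<rho> \<circ> cadjoint V \<circ> number_proj k \<circ> V)"

text \<open>\<open>\<langle>V\<^sup>\<dagger> N V\<rangle>\<close> for unitary \<open>V\<close>; \<open>\<langle>N\<rangle>\<close> is the case \<open>V = id\<close>.\<close>

definition number_expectation :: "('n fock \<Rightarrow> 'n fock) \<Rightarrow> ('n fock \<Rightarrow> 'n fock) \<Rightarrow> complex" where
  "number_expectation \<rho> V = (\<Sum>k. number_term \<rho> V k)"

end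

theory Submission
  imports Defs "HOL-Probability.Probability"
begin

text \<open>
  For \<open>x, y\<close> independent centred normal variables of variance \<open>\<sigma>\<close>, the average of the Weyl operators
  \<open>W((x + iy) e\<^sub>i)\<close> is \<open>(1 + \<sigma>)\<^sup>-\<^sup>1 s\<^bsup>N\<^sub>i\<^esup>\<close> with \<open>s = (1 - \<sigma>) / (1 + \<sigma>)\<close> and \<open>N\<^sub>i\<close> the number operator of
  mode \<open>i\<close>; this is a Gaussian integral on exponential vectors, and these are total.  Hence the generating
  function \<open>Tr \<rho> s\<^bsup>N\<^sub>i\<^esup>\<close> of the occupation numbers is a Gaussian average of the characteristic function,
  and letting \<open>\<sigma> \<rightarrow> 0\<close> expresses \<open>\<langle>N\<^sub>i\<rangle>\<close> through its second order behaviour at \<open>0\<close>.  Summing over the modes,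
  a state with characteristic function \<open>exp(- i \<surd>2 w\<cdot>z - z\<cdot>Sz)\<close> has \<open>\<langle>N\<rangle> = (Tr S - n + w\<cdot>w) / 2\<close>.
  Conjugating \<open>\<rho>\<close> by a Weyl operator translates \<open>w\<close>, and conjugating it by \<open>\<Gamma>(L)\<close> transforms \<open>w\<close> and \<open>S\<close>
  linearly by \<open>L\<^sup>-\<^sup>1\<close>, which gives both formulas.
\<close>

section \<open>The inner product\<close>

text \<open>The delicate point is the exchange of trace and Gaussian average, because the trace is
  only a sum over orthonormal bases. Cauchy-Schwarz for the form \<open>cinner f (\<rho> g)\<close>
  bounds the tail of Tr \<open>\<rho> W\<close> by the tail of the occupation probabilities of
  \<open>\<rho>\<close>, with one bound for all unitary \<open>W\<close>. So termwise integration is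
  done on finite sums only, and the error survives the averaging. The constants arise as follows. If
  \<Phi>(\<sigma>) is the averaged characteristic function, then Tr \<rho> s^(N_i) = (1 + \<sigma>)
  \<Phi>(\<sigma>), and \<Phi>(\<sigma>) = 1 - \<kappa> \<sigma> + o(\<sigma>), where \<kappa> is
  the trace of the mode's block of S plus the squared length of the mode's part of w. Hence 1 - Tr
  \<rho> s^(N_i) = (\<kappa> - 1) \<sigma> + o(\<sigma>), whereas 1 - s = 2 \<sigma> / (1 +
  \<sigma>); the quotient tends to (\<kappa> - 1) / 2. The summand -1 comes from the normalisation 1
  + \<sigma>; over all modes it gives -n/2, which cancels in the differences. N is unbounded and no
  finite mean is given beforehand, so finiteness has to come out of the same limit. It is stated as
  summability, since \<open>suminf\<close> of a divergent series carries no information.\<close>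

lemma cnj_mult_self: "cnj z * z = (complex_of_real (cmod z))\<^sup>2"
  and mult_cnj_self: "z * cnj z = (complex_of_real (cmod z))\<^sup>2"
  by (simp_all only: mult.commute complex_norm_square[symmetric] of_real_power)

lemmas fock_ext = amp_inject[THEN iffD1, OF ext]

lemmas amp_simps = plus_fock.rep_eq zero_fock.rep_eq fock_scale.rep_eq amp_diff

lemma amp_sum: "amp (\<Sum>i\<in>I. f i) xs = (\<Sum>i\<in>I. amp (f i) xs)"
  by (induction I rule: infinite_finite_induct) (auto simp: amp_simps)

lemma scaleC_add_right: "c *\<^sub>C (f + g) = c *\<^sub>C f + c *\<^sub>C g"
  and scaleC_add_left: "(c + d) *\<^sub>C f = c *\<^sub>C f + d *\<^sub>C f"
  and scaleC_scaleC [simp]: "c *\<^sub>C d *\<^sub>C f = (c * d) *\<^sub>C f"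
  and scaleC_one [simp]: "1 *\<^sub>C f = f"
  and scaleC_zero_left [simp]: "0 *\<^sub>C f = 0"
  and scaleC_zero_right [simp]: "c *\<^sub>C 0 = (0 :: 'n fock)"
  and scaleR_scaleC: "r *\<^sub>R f = complex_of_real r *\<^sub>C f"
  by (rule fock_ext; simp add: amp_simps scaleR_fock_def algebra_simps)+

lemma cinner_add_right: "cinner f (g + h) = cinner f g + cinner f h"
  by (simp add: cinner_def amp_simps distrib_left infsum_add cinner_summable)

lemma cinner_add_left: "cinner (f + g) h = cinner f h + cinner g h"
  by (simp add: cinner_def amp_simps distrib_right infsum_add cinner_summable)

lemma cinner_scale_right [simp]: "cinner f (c *\<^sub>C g) = c * cinner f g"
  by (simp add: cinner_def amp_simps mult.left_commute infsum_cmult_right')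

lemma cinner_scale_left [simp]: "cinner (c *\<^sub>C f) g = cnj c * cinner f g"
  by (simp add: cinner_def amp_simps mult.assoc infsum_cmult_right')

lemma cinner_commute: "cinner g f = cnj (cinner f g)"
  unfolding cinner_def infsum_cnj[symmetric] complex_cnj_mult complex_cnj_cnj
  by (simp only: mult.commute)

lemma cinner_zero [simp]: "cinner 0 g = 0" "cinner f 0 = 0"
  by (simp_all add: cinner_def amp_simps)

lemma cinner_minus_right: "cinner f (- g) = - cinner f g"
  and cinner_minus_left: "cinner (- f) g = - cinner f g"
  unfolding uminus_fock_def by (simp_all only: cinner_scale_right cinner_scale_left) simp_all

lemma cinner_diff_right: "cinner f (g - h) = cinner f g - cinner f h"
  and cinner_diff_left: "cinner (f - g) h = cinner f h - cinner g h"
  unfolding minus_fock_def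
  by (simp_all only: cinner_add_left cinner_add_right cinner_minus_left cinner_minus_right) simp_all

lemma cinner_sum_right: "cinner f (\<Sum>i\<in>I. g i) = (\<Sum>i\<in>I. cinner f (g i))"
  and cinner_sum_left: "cinner (\<Sum>i\<in>I. g i) f = (\<Sum>i\<in>I. cinner (g i) f)"
  by (induction I rule: infinite_finite_induct) (auto simp: cinner_add_left cinner_add_right)

lemma Re_cinner: "Re (cinner f g) = f \<bullet> g"
  by (simp add: inner_fock_def)

lemma cinner_self: "cinner f f = complex_of_real ((norm f)\<^sup>2)"
proof -
  have "Im (cinner f f) = 0"
    using arg_cong[OF cinner_commute[of f f], of Im] by simp
  then show ?thesis by (simp add: complex_eq_iff Re_cinner power2_norm_eq_inner)
qed

lemma norm_scaleC [simp]: "norm (c *\<^sub>C f) = cmod c * norm f"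
proof -
  have "complex_of_real ((norm (c *\<^sub>C f))\<^sup>2) = complex_of_real ((cmod c * norm f)\<^sup>2)"
    unfolding cinner_self[symmetric] cinner_scale_left cinner_scale_right
    by (simp add: cinner_self power_mult_distrib mult.left_commute mult_cnj_self cnj_mult_self)
  then show ?thesis by (simp only: of_real_eq_iff power2_eq_iff_nonneg norm_ge_zero mult_nonneg_nonneg)
qed

lemma norm_cinner_le: "cmod (cinner f g) \<le> norm f * norm g"
proof (cases "cinner f g = 0")
  case False
  \<comment> \<open>The phase \<open>c\<close> turns the complex inner product into its modulus, so
    the real Cauchy-Schwarz inequality applies.\<close>
  define c where "c = cnj (cinner f g) / cmod (cinner f g)"
  have "complex_of_real (cmod (cinner f g)) = cinner f (c *\<^sub>C g)"
    using False by (simp add: c_def cnj_mult_self power2_eq_square)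
  then have "cmod (cinner f g) = f \<bullet> (c *\<^sub>C g)"
    by (metis Re_cinner Re_complex_of_real)
  also have "\<dots> \<le> norm f * norm (c *\<^sub>C g)" by (rule norm_cauchy_schwarz)
  also have "norm (c *\<^sub>C g) = norm g" using False by (simp add: c_def norm_divide)
  finally show ?thesis .
qed simp

lemma bounded_bilinear_cinner: "bounded_bilinear cinner"
proof
  fix f g h :: "'a fock" and r :: real
  show "cinner (r *\<^sub>R f) g = r *\<^sub>R cinner f g" "cinner f (r *\<^sub>R g) = r *\<^sub>R cinner f g"
    by (simp_all add: scaleR_scaleC scaleR_conv_of_real)
  show "\<exists>K. \<forall>f g :: 'a fock. cmod (cinner f g) \<le> norm f * norm g * K"
    using norm_cinner_le by (intro exI[of _ 1]) auto
qed (auto simp: cinner_add_left cinner_add_right)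

lemmas tendsto_cinner [tendsto_intros] = bounded_bilinear.tendsto[OF bounded_bilinear_cinner]
lemmas continuous_on_cinner [continuous_intros] = bounded_bilinear.continuous_on[OF bounded_bilinear_cinner]
lemmas bounded_linear_cinner_right = bounded_bilinear.bounded_linear_right[OF bounded_bilinear_cinner]

lemma bounded_linear_scaleC: "bounded_linear (\<lambda>f. c *\<^sub>C f)"
  by (rule bounded_linear_intro[of _ "cmod c"])
     (auto simp: scaleC_add_right scaleR_scaleC mult.commute)

lemma cinner_ext: "(\<And>f. cinner f g = cinner f h) \<Longrightarrow> g = h"
  using cinner_self[of "g - h"] by (simp add: cinner_diff_right)

section \<open>Orthonormal bases\<close>

lemma onbD: "orthonormal_basis B \<Longrightarrow> b \<in> B \<Longrightarrow> b' \<in> B \<Longrightarrow> cinner b b' = (if b = b' then 1 else 0)"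
  and onb_complete: "orthonormal_basis B \<Longrightarrow> (\<And>b. b \<in> B \<Longrightarrow> cinner b f = 0) \<Longrightarrow> f = 0"
  unfolding orthonormal_basis_def by blast+

text \<open>For a finite part \<open>F\<close> of an orthonormal basis this is the orthogonal
  projection of \<open>f\<close> onto the span of \<open>F\<close>.\<close>

definition onb_sum :: "'n fock set \<Rightarrow> 'n fock \<Rightarrow> 'n fock" where
  "onb_sum F f = (\<Sum>b\<in>F. cinner b f *\<^sub>C b)"

lemma cinner_onb_sum:
  assumes "orthonormal_basis B" "F \<subseteq> B" "finite F" "b \<in> B"
  shows "cinner b (onb_sum F f) = (if b \<in> F then cinner b f else 0)"
proof -
  have "cinner b (onb_sum F f) = (\<Sum>b'\<in>F. if b = b' then cinner b' f else 0)"
    unfolding onb_sum_def cinner_sum_right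
    by (intro sum.cong refl) (use onbD[OF assms(1)] assms in auto)
  then show ?thesis using assms by simp
qed

lemma norm_onb_sum:
  assumes "orthonormal_basis B" "F \<subseteq> B" "finite F"
  shows "(norm (onb_sum F f))\<^sup>2 = (\<Sum>b\<in>F. (cmod (cinner b f))\<^sup>2)"
proof -
  have "complex_of_real ((norm (onb_sum F f))\<^sup>2) = (\<Sum>b\<in>F. cnj (cinner b f) * cinner b (onb_sum F f))"
    unfolding cinner_self[symmetric]
    by (subst (1) onb_sum_def) (simp add: cinner_sum_left)
  also have "\<dots> = (\<Sum>b\<in>F. complex_of_real ((cmod (cinner b f))\<^sup>2))"
    by (intro sum.cong refl)
       (use assms in \<open>auto simp: cinner_onb_sum[OF assms] subset_iff mult_cnj_self cnj_mult_self\<close>)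
  finally show ?thesis by (simp only: of_real_sum[symmetric] of_real_eq_iff)
qed

text \<open>Expand the squared norm of \<open>f - onb_sum F f\<close>, using that \<open>f\<close>
  and its projection have inner product equal to the squared norm of the projection.\<close>

lemma bessel:
  assumes "orthonormal_basis B" "F \<subseteq> B" "finite F"
  shows "(\<Sum>b\<in>F. (cmod (cinner b f))\<^sup>2) \<le> (norm f)\<^sup>2"
proof -
  have "cinner (onb_sum F f) f = (\<Sum>b\<in>F. complex_of_real ((cmod (cinner b f))\<^sup>2))"
    unfolding onb_sum_def cinner_sum_left
    by (intro sum.cong refl) (simp add: mult_cnj_self cnj_mult_self)
  then have "onb_sum F f \<bullet> f = (norm (onb_sum F f))\<^sup>2"
    unfolding Re_cinner[symmetric] norm_onb_sum[OF assms] by (simp only: of_real_sum[symmetric] Re_complex_of_real)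
  moreover have "0 \<le> (norm (f - onb_sum F f))\<^sup>2" by simp
  ultimately have "(norm (onb_sum F f))\<^sup>2 \<le> (norm f)\<^sup>2"
    unfolding power2_norm_eq_inner by (simp add: algebra_simps inner_commute)
  then show ?thesis using norm_onb_sum[OF assms] by simp
qed

lemma bessel_summable:
  assumes "orthonormal_basis B"
  shows "(\<lambda>b. (cmod (cinner b f))\<^sup>2) summable_on B"
  by (rule nonneg_bdd_above_summable_on, simp, rule bdd_aboveI[of _ "(norm f)\<^sup>2"])
     (use bessel[OF assms] in auto)

text \<open>Bessel makes suitable finite projections Cauchy; their limit differs from
  \<open>f\<close> by a vector orthogonal to the whole basis, which is zero by completeness of the
  basis. Countability of \<open>B\<close> is avoided by choosing finite sets that exhaust the
  coefficient mass up to \<open>1 / Suc n\<close>.\<close>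

lemma onb_expansion:
  assumes B: "orthonormal_basis B"
  shows "((\<lambda>b. cinner b f *\<^sub>C b) has_sum f) B"
proof -
  let ?c = "\<lambda>b. (cmod (cinner b f))\<^sup>2"
  define s where "s = infsum ?c B"
  have s: "(?c has_sum s) B" using bessel_summable[OF B] by (simp add: s_def)
  have dist_sum: "(norm (onb_sum F' f - onb_sum F f))\<^sup>2 \<le> s - sum ?c F"
    if "F \<subseteq> F'" "F' \<subseteq> B" "finite F'" for F F'
  proof -
    have fin: "finite F" "F \<subseteq> B" using that finite_subset by auto
    have "onb_sum F' f - onb_sum F f = onb_sum (F' - F) f"
      unfolding onb_sum_def using that by (simp add: sum_diff)
    moreover have "(norm (onb_sum (F' - F) f))\<^sup>2 = sum ?c (F' - F)"
      using that by (intro norm_onb_sum[OF B]) auto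
    moreover have "sum ?c (F' - F) = sum ?c F' - sum ?c F" using that by (simp add: sum_diff)
    moreover have "sum ?c F' \<le> s"
      unfolding s_def using that by (intro finite_sum_le_infsum bessel_summable B) auto
    ultimately show ?thesis by simp
  qed
  have "\<exists>F. finite F \<and> F \<subseteq> B \<and> dist (sum ?c F) s \<le> 1 / Suc n" for n
    by (rule has_sum_finite_approximation[OF s]) simp
  then obtain F where F: "\<And>n. finite (F n)" "\<And>n. F n \<subseteq> B"
    "\<And>n. dist (sum ?c (F n)) s \<le> 1 / Suc n" by metis
  \<comment> \<open>The sets \<open>F n\<close> need not be nested; their unions are, which the
    Cauchy argument requires.\<close>
  define E where "E n = (\<Union>k\<le>n. F k)" for n
  have E: "finite (E n)" "E n \<subseteq> B" "F n \<subseteq> E n" for n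
    using F by (auto simp: E_def)
  have E_mono: "m \<le> n \<Longrightarrow> E m \<subseteq> E n" for m n
    by (fastforce simp: E_def)
  have E_sum: "s - sum ?c (E n) \<le> 1 / Suc n" for n
  proof -
    have "sum ?c (F n) \<le> sum ?c (E n)" using E by (intro sum_mono2) auto
    then show ?thesis using F(3)[of n] by (simp add: dist_real_def)
  qed
  let ?X = "\<lambda>n. onb_sum (E n) f"
  have small: "norm (onb_sum F' f - ?X n) \<le> sqrt (1 / Suc n)" if "E n \<subseteq> F'" "F' \<subseteq> B" "finite F'" for n F'
    using dist_sum[OF that] E_sum[of n] by (intro real_le_rsqrt) linarith
  have lim0: "(\<lambda>n. sqrt (1 / Suc n)) \<longlonglongrightarrow> sqrt 0"
    by (intro tendsto_intros LIMSEQ_Suc[OF lim_1_over_n])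
  have "Cauchy ?X"
  proof (rule metric_CauchyI)
    fix e :: real assume "e > 0"
    then obtain N where N: "sqrt (1 / Suc N) < e / 2"
      using order_tendstoD(2)[OF lim0, of "e/2"] by (auto simp: eventually_sequentially)
    have "dist (?X m) (?X N) < e / 2" if "m \<ge> N" for m
      using small[OF E_mono[OF that] E(2,1)] N by (simp add: dist_norm)
    then show "\<exists>M. \<forall>m\<ge>M. \<forall>n\<ge>M. dist (?X m) (?X n) < e"
      by (meson dist_triangle_half_l dist_commute)
  qed
  then obtain g where g: "?X \<longlonglongrightarrow> g" using Cauchy_convergent convergent_def by blast
  have "f - g = 0"
  proof (rule onb_complete[OF B])
    fix b assume b: "b \<in> B"
    \<comment> \<open>Inside \<open>E n\<close> the coefficient of the difference vanishes; outside,
      its square is part of the mass missing from \<open>E n\<close>. The bound therefore also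
      covers a \<open>b\<close> lying in no \<open>E n\<close>.\<close>
    have "cmod (cinner b (f - ?X n)) \<le> sqrt (1 / Suc n)" for n
    proof (cases "b \<in> E n")
      case True
      then show ?thesis by (simp add: cinner_diff_right cinner_onb_sum[OF B E(2,1) b])
    next
      case False
      have "sum ?c (insert b (E n)) \<le> s"
        unfolding s_def using E b by (intro finite_sum_le_infsum bessel_summable B) auto
      then have "?c b \<le> 1 / Suc n" using False E(1)[of n] E_sum[of n] by simp
      then show ?thesis
        using False by (simp add: cinner_diff_right cinner_onb_sum[OF B E(2,1) b] real_le_rsqrt)
    qed
    moreover have "(\<lambda>n. cmod (cinner b (f - ?X n))) \<longlonglongrightarrow> cmod (cinner b (f - g))"
      by (intro tendsto_intros g)
    ultimately have "cmod (cinner b (f - g)) \<le> sqrt 0"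
      using LIMSEQ_le[OF _ lim0] by blast
    then show "cinner b (f - g) = 0" by simp
  qed
  then have g: "?X \<longlonglongrightarrow> f" using g by simp
  show ?thesis
    unfolding has_sum_def tendsto_iff eventually_finite_subsets_at_top
  proof (intro allI impI)
    fix e :: real assume "e > 0"
    then have "\<forall>\<^sub>F n in sequentially. sqrt (1 / Suc n) < e / 2 \<and> dist (?X n) f < e / 2"
      by (intro eventually_conj order_tendstoD(2)[OF lim0] tendstoD[OF g]) auto
    then obtain N where N: "sqrt (1 / Suc N) < e / 2" "dist (?X N) f < e / 2"
      by (auto simp: eventually_sequentially)
    have "dist (\<Sum>b\<in>F'. cinner b f *\<^sub>C b) f < e" if "finite F'" "F' \<subseteq> B" "E N \<subseteq> F'" for F'
    proof -
      have "dist (onb_sum F' f) (?X N) < e / 2"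
        using small[OF that(3,2,1)] N by (simp add: dist_norm)
      then show ?thesis using N(2) dist_triangle_half_l[of _ "?X N"]
        by (metis dist_commute onb_sum_def)
    qed
    then show "\<exists>X. finite X \<and> X \<subseteq> B \<and>
        (\<forall>Y. finite Y \<and> X \<subseteq> Y \<and> Y \<subseteq> B \<longrightarrow> dist (\<Sum>b\<in>Y. cinner b f *\<^sub>C b) f < e)"
      by (intro exI[of _ "E N"] conjI E allI impI) (elim conjE)
  qed
qed

lemma parseval:
  assumes "orthonormal_basis B"
  shows "((\<lambda>b. cinner f b * cinner b g) has_sum cinner f g) B"
proof -
  have "((\<lambda>b. cinner f (cinner b g *\<^sub>C b)) has_sum cinner f g) B"
    by (rule has_sum_bounded_linear[OF bounded_linear_cinner_right onb_expansion[OF assms]])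
  then show ?thesis by (simp only: cinner_scale_right mult.commute)
qed

section \<open>The occupation number basis\<close>

lemma finite_lists_mset: "finite {ys :: 'n::finite list. mset ys = A}"
  by (rule finite_subset[OF _ finite_lists_length[of "size A"]]) auto

definition nperm :: "'n::finite multiset \<Rightarrow> nat" where
  "nperm A = card {ys. mset ys = A}"

lemma nperm_pos [simp]: "nperm A > 0"
  unfolding nperm_def using finite_lists_mset[of A] ex_mset[of A] by (auto simp: card_gt_0_iff)

lemma nperm_neq_0 [simp]: "nperm A \<noteq> 0"
  using nperm_pos[of A] by simp

lemma norm_fock_mono:
  assumes "\<And>xs. cmod (amp f xs) \<le> c * cmod (amp g xs)" "c \<ge> 0"
  shows "norm f \<le> c * norm g"
proof (rule power2_le_imp_le)
  have "(norm f)\<^sup>2 \<le> (\<Sum>\<^sub>\<infinity>xs. c\<^sup>2 * (cmod (amp g xs))\<^sup>2)"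
    unfolding norm_fock_sq power_mult_distrib[symmetric]
    by (intro infsum_mono amp_summable power_mono assms norm_ge_zero)
       (simp add: power_mult_distrib amp_summable summable_on_cmult_right)
  then show "(norm f)\<^sup>2 \<le> (c * norm g)\<^sup>2"
    by (simp add: infsum_cmult_right' norm_fock_sq power_mult_distrib)
qed (use assms in simp)

text \<open>Occupation number patterns are multisets of modes; \<open>nperm A\<close> is the multinomial coefficient.\<close>

lift_definition nvec :: "'n::finite multiset \<Rightarrow> 'n fock"
  is "\<lambda>A xs. if mset xs = A then 1 / complex_of_real (sqrt (nperm A)) else 0"
proof
  fix A :: "'n multiset"
  show "(\<lambda>xs. (cmod (if mset xs = A then 1 / complex_of_real (sqrt (nperm A)) else 0))\<^sup>2) summable_on UNIV"
    by (intro finite_nonzero_values_imp_summable_on finite_subset[OF _ finite_lists_mset[of A]])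
       (auto split: if_splits)
qed simp

text \<open>By symmetry \<open>amp f\<close> is constant on the \<open>nperm\<close> lists sharing
  one multiset, and each enters with weight 1 / sqrt \<open>nperm\<close>. Coefficients and
  amplitudes thus determine each other, which yields completeness of these vectors.\<close>

lemma cinner_nvec: "cinner (nvec (mset xs)) f = sqrt (nperm (mset xs)) * amp f xs"
proof -
  have "((\<lambda>ys. cnj (amp (nvec (mset xs)) ys) * amp f ys) has_sum
      (\<Sum>ys | mset ys = mset xs. cnj (amp (nvec (mset xs)) ys) * amp f ys)) UNIV"
    by (rule has_sum_finite_neutralI[OF finite_lists_mset[of "mset xs"]]) (auto simp: nvec.rep_eq)
  then have "cinner (nvec (mset xs)) f =
      (\<Sum>ys | mset ys = mset xs. cnj (amp (nvec (mset xs)) ys) * amp f ys)"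
    unfolding cinner_def by (rule infsumI)
  also have "\<dots> = (\<Sum>ys | mset ys = mset xs. amp f xs / sqrt (nperm (mset xs)))"
  proof (rule sum.cong)
    fix ys assume "ys \<in> {ys. mset ys = mset xs}"
    then have "mset ys = mset xs" by simp
    with amp_perm[OF this, of f]
    show "cnj (amp (nvec (mset xs)) ys) * amp f ys = amp f xs / sqrt (nperm (mset xs))"
      by (simp add: nvec.rep_eq)
  qed simp
  also have "\<dots> = sqrt (nperm (mset xs)) * amp f xs"
  proof -
    have "real (nperm (mset xs)) = sqrt (nperm (mset xs)) * sqrt (nperm (mset xs))" by simp
    then have "complex_of_nat (nperm (mset xs))
        = complex_of_real (sqrt (nperm (mset xs))) * complex_of_real (sqrt (nperm (mset xs)))"
      by (metis of_real_mult of_real_of_nat_eq)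
    then show ?thesis by (simp add: nperm_def[symmetric])
  qed
  finally show ?thesis .
qed

lemma cinner_nvec_nvec: "cinner (nvec A) (nvec B) = (if A = B then 1 else 0)"
proof -
  obtain xs where "A = mset xs" using ex_mset by metis
  then show ?thesis by (auto simp: cinner_nvec nvec.rep_eq)
qed

lemma inj_nvec: "inj nvec"
  by (rule injI) (metis cinner_nvec_nvec one_neq_zero)

lemma onb_nvec: "orthonormal_basis (range nvec)"
  unfolding orthonormal_basis_def
proof (intro conjI ballI allI impI)
  fix f :: "'a fock" assume f: "\<forall>b\<in>range nvec. cinner b f = 0"
  show "f = 0"
  proof (rule fock_ext)
    fix xs show "amp f xs = amp 0 xs"
      using f[rule_format, of "nvec (mset xs)"] by (simp add: cinner_nvec zero_fock.rep_eq)
  qed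
qed (auto simp: cinner_nvec_nvec)

lemma has_sum_nvec_iff: "(f has_sum s) (range nvec) \<longleftrightarrow> ((\<lambda>A. f (nvec A)) has_sum s) UNIV"
  using has_sum_reindex[OF inj_nvec, of f s] by (simp add: o_def)

lemma finite_size_eq: "finite {A :: 'n::finite multiset. size A = k}"
proof -
  have "{A :: 'n multiset. size A = k} \<subseteq> mset ` {xs. length xs = k}"
  proof
    fix A :: "'n multiset" assume "A \<in> {A. size A = k}"
    then obtain xs where "mset xs = A" "length xs = k" using ex_mset[of A] by auto
    then show "A \<in> mset ` {xs. length xs = k}" by auto
  qed
  then show ?thesis using finite_lists_length finite_subset by blast
qed

text \<open>Only finitely many patterns have size \<open>k\<close>, so the projection has finite
  rank; the traces in \<open>number_term\<close> become finite sums.\<close>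

lemma number_proj_nvec: "number_proj k f = (\<Sum>A | size A = k. cinner (nvec A) f *\<^sub>C nvec A)"
proof (rule fock_ext)
  fix xs :: "'a list"
  have "amp (\<Sum>A | size A = k. cinner (nvec A) f *\<^sub>C nvec A) xs
      = (\<Sum>A | size A = k. if A = mset xs then amp f xs else 0)"
    unfolding amp_sum by (intro sum.cong refl) (auto simp: amp_simps nvec.rep_eq cinner_nvec)
  then show "amp (number_proj k f) xs = amp (\<Sum>A | size A = k. cinner (nvec A) f *\<^sub>C nvec A) xs"
    by (simp add: number_proj.rep_eq finite_size_eq)
qed

section \<open>Exponential vectors\<close>

lemma prod_list_count:
  fixes h :: "'n::finite \<Rightarrow> 'a::comm_monoid_mult"
  shows "prod_list (map h xs) = (\<Prod>i\<in>UNIV. h i ^ count (mset xs) i)"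
proof -
  have "prod_list (map h xs) = prod_mset (image_mset h (mset xs))"
    by (simp flip: prod_mset_prod_list mset_map)
  also have "\<dots> = (\<Prod>i\<in>set_mset (mset xs). h i ^ count (mset xs) i)"
    by (rule image_prod_mset_multiplicity)
  also have "\<dots> = (\<Prod>i\<in>UNIV. h i ^ count (mset xs) i)"
  proof (rule prod.mono_neutral_left)
    have "count (mset xs) i = 0" if "i \<notin> set_mset (mset xs)" for i
      using that by (simp only: count_eq_zero_iff not_False_eq_True)
    then show "\<forall>i\<in>UNIV - set_mset (mset xs). h i ^ count (mset xs) i = 1" by (metis DiffD2 power_0)
  qed auto
  finally show ?thesis .
qed

lemma sum_prod_list_lists:
  fixes h :: "'n::finite \<Rightarrow> 'a::comm_semiring_1"
  shows "(\<Sum>xs | length xs = r. prod_list (map h xs)) = (\<Sum>i\<in>UNIV. h i) ^ r"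
proof (induction r)
  case (Suc r)
  have eq: "{xs :: 'n list. length xs = Suc r} = (\<lambda>(i, xs). i # xs) ` (UNIV \<times> {xs. length xs = r})"
    by (auto simp: length_Suc_conv image_iff)
  have "(\<Sum>xs | length xs = Suc r. prod_list (map h xs))
      = (\<Sum>(i, xs)\<in>UNIV \<times> {xs. length xs = r}. h i * prod_list (map h xs))"
    unfolding eq by (subst sum.reindex) (auto simp: inj_on_def case_prod_beta)
  also have "\<dots> = (\<Sum>i\<in>UNIV. h i) * (\<Sum>xs | length xs = r. prod_list (map h xs))"
    by (simp add: sum_product sum.cartesian_product)
  finally show ?case using Suc.IH by simp
qed simp

lemma cinner_expvec: "cinner (expvec u) (expvec v) = exp (cdot u v)" for u :: "complex ^ 'n::finite"
proof -
  let ?f = "\<lambda>xs. cnj (amp (expvec u) xs) * amp (expvec v) xs"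
  let ?S = "\<lambda>n. \<Union>r\<in>{..<n}. {xs :: 'n list. length xs = r}"
  let ?h = "\<lambda>i. cnj (u $ i) * v $ i"
  have f: "?f xs = prod_list (map ?h xs) / fact (length xs)" for xs
    by (simp add: expvec.rep_eq prod_list_count power_mult_distrib prod.distrib flip: of_real_mult)
  \<comment> \<open>The sets of lists shorter than \<open>n\<close> are cofinal among the finite
    sets, so the unordered sum may be computed along them; there it is a partial sum of the
    exponential series.\<close>
  have "filterlim ?S (finite_subsets_at_top UNIV) sequentially"
    unfolding filterlim_iff eventually_finite_subsets_at_top
  proof safe
    fix P and X :: "'n list set"
    assume X: "finite X" and P: "\<forall>Y. finite Y \<and> X \<subseteq> Y \<and> Y \<subseteq> UNIV \<longrightarrow> P Y"
    define R where "R = Suc (Max (insert 0 (length ` X)))"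
    have "X \<subseteq> ?S n" if "n \<ge> R" for n
    proof
      fix xs assume "xs \<in> X"
      then have "length xs < R" using X by (auto simp: R_def less_Suc_eq_le intro!: Max_ge)
      then show "xs \<in> ?S n" using that by auto
    qed
    then show "\<forall>\<^sub>F n in sequentially. P (?S n)"
      by (intro eventually_sequentiallyI[of R] P[rule_format]) (auto simp: finite_lists_length)
  qed
  moreover have "((\<lambda>F. sum ?f F) \<longlongrightarrow> cinner (expvec u) (expvec v)) (finite_subsets_at_top UNIV)"
    unfolding cinner_def by (rule infsum_tendsto[OF cinner_summable])
  ultimately have 1: "(\<lambda>n. sum ?f (?S n)) \<longlonglongrightarrow> cinner (expvec u) (expvec v)"
    using filterlim_compose by blast
  have "sum ?f (?S n) = (\<Sum>r<n. cdot u v ^ r /\<^sub>R fact r)" for n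
  proof -
    have "sum ?f (?S n) = (\<Sum>r<n. \<Sum>xs | length xs = r. ?f xs)"
      by (rule sum.UNION_disjoint) (auto simp: finite_lists_length)
    also have "\<dots> = (\<Sum>r<n. (\<Sum>xs | length xs = r. prod_list (map ?h xs)) / fact r)"
      unfolding f sum_divide_distrib by (intro sum.cong refl) auto
    finally show ?thesis
      by (simp add: sum_prod_list_lists cdot_def scaleR_conv_of_real field_simps)
  qed
  then have 2: "(\<lambda>n. sum ?f (?S n)) \<longlonglongrightarrow> exp (cdot u v)"
    using exp_converges[of "cdot u v"] by (simp add: sums_def)
  show ?thesis using LIMSEQ_unique[OF 1 2] .
qed

lemma continuous_on_cdot [continuous_intros]:
  assumes "continuous_on S f" "continuous_on S g"
  shows "continuous_on S (\<lambda>x. cdot (f x) (g x))"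
  unfolding cdot_def by (intro continuous_intros assms)

text \<open>The squared distance of two exponential vectors is a combination of exponentials of
  inner products.\<close>

lemma continuous_on_expvec: "continuous_on UNIV (expvec :: complex ^ 'n::finite \<Rightarrow> _)"
  unfolding continuous_on_def
proof
  fix u :: "complex ^ 'n"
  let ?h = "\<lambda>v. exp (cdot v v) - exp (cdot v u) - exp (cdot u v) + exp (cdot u u)"
  have eq: "complex_of_real ((norm (expvec v - expvec u))\<^sup>2) = ?h v" for v :: "complex ^ 'n"
    unfolding cinner_self[symmetric] by (simp add: cinner_diff_left cinner_diff_right cinner_expvec)
  have "continuous_on UNIV (\<lambda>v. sqrt (Re (?h v)))" by (intro continuous_intros)
  then have "((\<lambda>v. sqrt (Re (?h v))) \<longlongrightarrow> sqrt (Re (?h u))) (at u)"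
    unfolding continuous_on_def by blast
  moreover have "sqrt (Re (?h v)) = norm (expvec v - expvec u)" for v
    unfolding eq[symmetric] Re_complex_of_real by simp
  ultimately have "((\<lambda>v. norm (expvec v - expvec u)) \<longlongrightarrow> 0) (at u)" by simp
  then show "(expvec \<longlongrightarrow> expvec u) (at u within UNIV)"
    by (rule LIM_zero_cancel[OF tendsto_norm_zero_cancel])
qed

text \<open>Orthogonality of the characters of the cyclic group of order \<open>M\<close>. The norm
  bound is stated for all \<open>a\<close>, \<open>b\<close>, so that it covers occupation numbers
  beyond \<open>M\<close>, where distinct values may give the same character.\<close>

lemma sum_root_unity_power:
  fixes a b M :: nat
  assumes "M > 0"
  defines "r \<equiv> cis (2 * pi * b / M) / cis (2 * pi * a / M)"
  shows "cmod (\<Sum>m<M. r ^ m) \<le> M"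
    and "a < M \<Longrightarrow> b < M \<Longrightarrow> (\<Sum>m<M. r ^ m) = (if a = b then of_nat M else 0)"
proof -
  have "cmod (\<Sum>m<M. r ^ m) \<le> (\<Sum>m<M. cmod (r ^ m))" by (rule norm_sum)
  also have "\<dots> = M" by (simp add: r_def norm_power norm_divide)
  finally show "cmod (\<Sum>m<M. r ^ m) \<le> M" .
  assume ab: "a < M" "b < M"
  have pow: "cis (2 * pi * k / M) ^ M = 1" for k :: nat
  proof -
    have "cis (2 * pi * k / M) ^ M = cis (2 * pi * k)"
      using assms(1) by (simp add: Complex.DeMoivre)
    then show ?thesis by (simp add: cis_multiple_2pi)
  qed
  then have rM: "r ^ M = 1" by (simp add: r_def power_divide)
  show "(\<Sum>m<M. r ^ m) = (if a = b then of_nat M else 0)"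
  proof (cases "a = b")
    case False
    then have "cis (2 * pi * b / M) \<noteq> cis (2 * pi * a / M)"
      using bij_betw_imp_inj_on[OF Complex.bij_betw_roots_unity[OF assms(1)]] ab by (auto simp: inj_on_def)
    then have "r \<noteq> 1" by (simp add: r_def)
    then show ?thesis using False rM by (simp add: geometric_sum)
  qed (simp add: r_def)
qed

text \<open>
  The vector \<open>nvec A\<close> is the limit as \<open>t \<rightarrow> 0\<close> of \<open>t\<^sup>-\<^sup>k\<close> times a Fourier average of \<open>expvec (t \<zeta>)\<close>
  over vectors \<open>\<zeta>\<close> of \<open>(k + 1)\<close>-st roots of unity, \<open>k = size A\<close>: the average kills every other
  occupation number pattern of size at most \<open>k\<close>, and larger patterns carry a factor \<open>t\<close>.
\<close>

lemma nvec_approx: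
  fixes A :: "'n::finite multiset"
  shows "\<exists>(I :: ('n \<Rightarrow> nat) set) v w a. finite I \<and> a \<noteq> 0 \<and>
    ((\<lambda>m::nat. \<Sum>j\<in>I. w m j *\<^sub>C expvec (v m j)) \<longlonglongrightarrow> a *\<^sub>C nvec A)"
proof -
  define k where "k = size A"
  define M where "M = Suc k"
  define \<zeta> where "\<zeta> b = cis (2 * pi * real b / M)" for b :: nat
  define I where "I = PiE (UNIV :: 'n set) (\<lambda>_. {..<M})"
  define v where "v m j = (\<chi> i. complex_of_real (1 / Suc m) * \<zeta> (j i))" for m and j :: "'n \<Rightarrow> nat"
  define w where "w m j = of_nat (Suc m) ^ k / of_nat M ^ CARD('n) * (\<Prod>i\<in>UNIV. 1 / \<zeta> (count A i) ^ j i)"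
    for m and j :: "'n \<Rightarrow> nat"
  \<comment> \<open>This is the coefficient of \<open>nvec A\<close> in the exponential vector of
    (1, ..., 1).\<close>
  define a where "a = complex_of_real (sqrt (nperm A) / sqrt (fact k))"
  define X where "X m = (\<Sum>j\<in>I. w m j *\<^sub>C expvec (v m j))" for m
  define C where "C B = (\<Prod>i\<in>UNIV. \<Sum>l<M. (\<zeta> (count B i) / \<zeta> (count A i)) ^ l)" for B
  have M: "M > 0" by (simp add: M_def)
  have \<zeta>_swap: "\<zeta> l ^ b = \<zeta> b ^ l" for l b
    by (simp add: \<zeta>_def Complex.DeMoivre mult_ac)
  have amp_X: "amp (X m) xs = of_nat (Suc m) ^ k / of_nat M ^ CARD('n) * C (mset xs)
      * complex_of_real (1 / Suc m) ^ length xs / sqrt (fact (length xs))" for m xs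
  proof -
    let ?B = "mset xs"
    let ?c = "of_nat (Suc m) ^ k / of_nat M ^ CARD('n) * complex_of_real (1 / Suc m) ^ length xs
      / complex_of_real (sqrt (fact (length xs)))"
    have len: "(\<Prod>i\<in>UNIV. (c::complex) ^ count ?B i) = c ^ length xs" for c
      using prod_list_count[of "\<lambda>_. c" xs] by (simp add: map_replicate_const)
    have "w m j * amp (expvec (v m j)) xs
        = ?c * (\<Prod>i\<in>UNIV. (\<zeta> (count ?B i) / \<zeta> (count A i)) ^ j i)" for j
      by (simp add: w_def v_def expvec.rep_eq prod_list_count power_mult_distrib prod.distrib len
          power_divide prod_dividef \<zeta>_swap[of "j _"])
    then have "amp (X m) xs = ?c * (\<Sum>j\<in>I. \<Prod>i\<in>UNIV. (\<zeta> (count ?B i) / \<zeta> (count A i)) ^ j i)"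
      by (simp add: X_def amp_sum amp_simps sum_distrib_left)
    also have "(\<Sum>j\<in>I. \<Prod>i\<in>UNIV. (\<zeta> (count ?B i) / \<zeta> (count A i)) ^ j i) = C ?B"
      unfolding C_def I_def by (rule prod_sum_PiE[symmetric]) auto
    finally show ?thesis by simp
  qed
  have C_le: "cmod (C B) \<le> real M ^ CARD('n)" for B
  proof -
    have "cmod (C B) = (\<Prod>i\<in>UNIV. cmod (\<Sum>l<M. (\<zeta> (count B i) / \<zeta> (count A i)) ^ l))"
      unfolding C_def by (rule prod_norm[symmetric])
    also have "\<dots> \<le> (\<Prod>i\<in>(UNIV :: 'n set). real M)"
      unfolding \<zeta>_def by (intro prod_mono conjI norm_ge_zero sum_root_unity_power(1)[OF M])
    finally show ?thesis by simp
  qed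
  have C_eq: "C B = (if B = A then of_nat M ^ CARD('n) else 0)" if "size B \<le> k" for B
  proof -
    have lt: "count A i < M" "count B i < M" for i
      using that count_le_size[of A i] count_le_size[of B i] by (auto simp: M_def k_def)
    have "C B = (\<Prod>i\<in>UNIV. if count A i = count B i then of_nat M else 0)"
      unfolding C_def \<zeta>_def using sum_root_unity_power(2)[OF M lt] by simp
    also have "\<dots> = (if B = A then of_nat M ^ CARD('n) else 0)"
    proof (cases "B = A")
      case False
      then obtain i where "count A i \<noteq> count B i" by (metis multiset_eqI)
      then show ?thesis using False by (auto intro!: prod_zero)
    qed simp
    finally show ?thesis .
  qed
  \<comment> \<open>The difference vanishes exactly on lists of length at most \<open>k\<close>. On
    longer lists the surplus power of \<open>1 / Suc m\<close> remains after the factor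
    \<open>Suc m ^ k\<close>, and the rest is dominated by the exponential vector of (1, ...,
    1).\<close>
  have bound: "norm (X m - a *\<^sub>C nvec A) \<le> (1 / Suc m) * norm (expvec (\<chi> i::'n. 1))" for m
  proof (rule norm_fock_mono)
    fix xs :: "'n list"
    let ?E = "amp (expvec (\<chi> i::'n. 1)) xs" and ?t = "1 / real (Suc m)"
    have E: "?E = 1 / sqrt (fact (length xs))"
      by (simp add: expvec.rep_eq map_replicate_const prod_list_count)
    show "cmod (amp (X m - a *\<^sub>C nvec A) xs) \<le> ?t * cmod ?E"
    proof (cases "length xs \<le> k")
      case True
      have "amp (X m - a *\<^sub>C nvec A) xs = 0"
      proof (cases "mset xs = A")
        case True
        then have len: "length xs = k" by (auto simp: k_def)
        have "of_nat (Suc m) ^ k * complex_of_real (1 / real (Suc m)) ^ k = 1"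
          by (simp add: power_divide del: of_nat_Suc)
        then have "amp (X m) xs = 1 / sqrt (fact k)"
          using True M len C_eq[of A] by (simp add: amp_X k_def[symmetric] field_simps del: of_nat_Suc)
        then show ?thesis using True by (simp add: amp_simps nvec.rep_eq a_def)
      next
        case False
        then show ?thesis using \<open>length xs \<le> k\<close> by (simp add: amp_simps amp_X C_eq nvec.rep_eq)
      qed
      then show ?thesis by simp
    next
      case False
      then obtain d where d: "length xs = k + Suc d" using less_imp_Suc_add by fastforce
      have "mset xs \<noteq> A" using False by (auto simp: k_def)
      then have "cmod (amp (X m - a *\<^sub>C nvec A) xs) = real (Suc m) ^ k / real M ^ CARD('n)
          * cmod (C (mset xs)) * ?t ^ length xs * cmod ?E"
        by (simp add: amp_simps amp_X nvec.rep_eq E norm_mult norm_divide norm_power del: of_nat_Suc)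
      also have "\<dots> = cmod (C (mset xs)) / real M ^ CARD('n) * ?t ^ Suc d * cmod ?E"
        unfolding d power_add by (simp add: power_divide)
      also have "\<dots> \<le> 1 * ?t * cmod ?E"
        using C_le[of "mset xs"] M power_decreasing[of 1 "Suc d" ?t]
        by (intro mult_mono mult_right_mono) auto
      finally show ?thesis by simp
    qed
  qed simp
  have "(\<lambda>m. (1 / Suc m) * norm (expvec (\<chi> i::'n. 1))) \<longlonglongrightarrow> 0 * norm (expvec (\<chi> i::'n. 1))"
    by (intro tendsto_intros LIMSEQ_Suc[OF lim_1_over_n])
  then have "(\<lambda>m. (1 / Suc m) * norm (expvec (\<chi> i::'n. 1))) \<longlonglongrightarrow> 0" by simp
  then have "(\<lambda>m. X m - a *\<^sub>C nvec A) \<longlonglongrightarrow> 0"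
    by (rule Lim_null_comparison[OF always_eventually[OF allI[OF bound]]])
  then have "X \<longlonglongrightarrow> a *\<^sub>C nvec A" by (simp add: LIM_zero_cancel)
  moreover have "a \<noteq> 0" using nperm_pos[of A] by (simp add: a_def)
  moreover have "finite I" unfolding I_def by (intro finite_PiE) auto
  ultimately show ?thesis unfolding X_def by blast
qed

text \<open>Totality of the exponential vectors, phrased as an induction rule:
  \<open>nvec_approx\<close> carries the property to the occupation number basis, and the basis
  expansion carries it to every vector.\<close>

lemma expvec_dense [consumes 0, case_names closed add scale exp]:
  fixes P :: "'n::finite fock \<Rightarrow> bool"
  assumes closed: "closed {f. P f}"
    and add: "\<And>f g. P f \<Longrightarrow> P g \<Longrightarrow> P (f + g)"
    and scale: "\<And>c f. P f \<Longrightarrow> P (c *\<^sub>C f)"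
    and exp: "\<And>v. P (expvec v)"
  shows "P f"
proof -
  have P0: "P 0" using scale[OF exp, of 0] by simp
  have P_sum: "P (\<Sum>i\<in>I. g i)" if "\<And>i. i \<in> I \<Longrightarrow> P (g i)" for I and g :: "'i \<Rightarrow> 'n fock"
    using that by (induction I rule: infinite_finite_induct) (auto intro: add P0)
  have P_nvec: "P (nvec A)" for A
  proof -
    obtain I :: "('n \<Rightarrow> nat) set" and v w a where
      I: "finite I" "a \<noteq> 0" "(\<lambda>m::nat. \<Sum>j\<in>I. w m j *\<^sub>C expvec (v m j)) \<longlonglongrightarrow> a *\<^sub>C nvec A"
      using nvec_approx by blast
    have "P (a *\<^sub>C nvec A)"
      using closed_sequentially[OF closed _ I(3)] by (simp add: P_sum scale exp)
    from scale[OF this, of "1 / a"] show ?thesis using I(2) by simp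
  qed
  have "((\<lambda>b. cinner b f *\<^sub>C b) has_sum f) (range nvec)"
    by (rule onb_expansion[OF onb_nvec])
  then have "((\<lambda>F. \<Sum>b\<in>F. cinner b f *\<^sub>C b) \<longlongrightarrow> f) (finite_subsets_at_top (range nvec))"
    by (simp add: has_sum_def)
  moreover have "\<forall>\<^sub>F F in finite_subsets_at_top (range nvec). (\<Sum>b\<in>F. cinner b f *\<^sub>C b) \<in> {f. P f}"
    by (rule eventually_finite_subsets_at_top_weakI) (auto intro!: P_sum scale P_nvec)
  ultimately have "f \<in> {f. P f}"
    using Lim_in_closed_set[OF closed] finite_subsets_at_top_neq_bot by blast
  then show ?thesis by simp
qed

section \<open>Unitary operators\<close>

lemma bounded_bilinear_scaleC: "bounded_bilinear (fock_scale :: complex \<Rightarrow> 'n fock \<Rightarrow> 'n fock)"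
proof
  show "\<exists>K. \<forall>c (f :: 'n fock). norm (c *\<^sub>C f) \<le> norm c * norm f * K"
    by (intro exI[of _ 1]) simp
qed (simp_all add: scaleC_add_left scaleC_add_right scaleR_scaleC scaleR_conv_of_real mult.commute)

lemma cbounded_linearD:
  assumes "cbounded_linear T"
  shows "bounded_linear T" "T (c *\<^sub>C f) = c *\<^sub>C T f"
  using assms unfolding cbounded_linear_def by blast+

lemma cbounded_linear_add: "cbounded_linear T \<Longrightarrow> T (f + g) = T f + T g"
  by (rule linear_add[OF bounded_linear.linear[OF cbounded_linearD(1)]])

lemma cbounded_linear_sum: "cbounded_linear T \<Longrightarrow> T (\<Sum>i\<in>I. g i) = (\<Sum>i\<in>I. T (g i))"
  by (rule linear_sum[OF bounded_linear.linear[OF cbounded_linearD(1)]])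

lemma cbounded_linear_compose: "cbounded_linear S \<Longrightarrow> cbounded_linear T \<Longrightarrow> cbounded_linear (S \<circ> T)"
  unfolding cbounded_linear_def o_def by (auto intro: bounded_linear_compose)

lemma cbounded_linear_scale: "cbounded_linear T \<Longrightarrow> cbounded_linear (\<lambda>f. c *\<^sub>C T f)"
  unfolding cbounded_linear_def
  by (auto intro: bounded_linear_compose[OF bounded_linear_scaleC] simp: mult.commute)

lemma cbounded_linear_eqI:
  assumes S: "cbounded_linear S" and T: "cbounded_linear T" and "\<And>v. S (expvec v) = T (expvec v)"
  shows "S = T"
proof
  fix f show "S f = T f"
  proof (induction f rule: expvec_dense)
    case closed
    show ?case
      by (intro closed_Collect_eq linear_continuous_on cbounded_linearD(1)[OF S]
          cbounded_linearD(1)[OF T])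
  qed (simp_all add: assms cbounded_linear_add cbounded_linearD(2)[OF S] cbounded_linearD(2)[OF T])
qed

lemma unitary_opD:
  assumes "unitary_op U"
  shows unitary_op_cbounded: "cbounded_linear U"
    and unitary_op_cinner: "cinner (U f) (U g) = cinner f g"
    and unitary_op_bij: "bij U"
    and unitary_op_norm: "norm (U f) = norm f"
    and unitary_op_inv_left [simp]: "inv U (U f) = f"
    and unitary_op_inv_right [simp]: "U (inv U f) = f"
proof -
  show U: "cbounded_linear U" and ci: "cinner (U f) (U g) = cinner f g" for f g
    using assms unfolding unitary_op_def by blast+
  show norm: "norm (U f) = norm f" for f
    using ci[of f f] unfolding cinner_self by (simp only: of_real_eq_iff) simp
  have "inj U"
  proof (rule injI)
    fix f g assume "U f = U g"
    then have "norm (U (f - g)) = 0"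
      using bounded_linear.linear[OF cbounded_linearD(1)[OF U]] by (simp add: linear_diff)
    then show "f = g" by (simp add: norm)
  qed
  then show "bij U" using assms by (simp add: bij_def unitary_op_def)
  then show "inv U (U f) = f" "U (inv U f) = f"
    by (simp_all add: bij_is_inj bij_is_surj surj_f_inv_f)
qed

lemma unitary_op_id: "unitary_op id"
  by (simp add: unitary_op_def cbounded_linear_def bounded_linear_ident id_def)

lemma cinner_inv_left: "unitary_op U \<Longrightarrow> cinner (inv U f) g = cinner f (U g)"
  by (metis unitary_op_cinner unitary_op_inv_right)

lemma cinner_inv_right: "unitary_op U \<Longrightarrow> cinner g (inv U f) = cinner (U g) f"
  by (metis unitary_op_cinner unitary_op_inv_right)

lemma unitary_op_inv:
  assumes U: "unitary_op U"
  shows "unitary_op (inv U)"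
proof -
  have add: "inv U (f + g) = inv U f + inv U g" for f g
    by (rule cinner_ext) (simp add: cinner_inv_right[OF U] cinner_add_right)
  have scale: "inv U (c *\<^sub>C f) = c *\<^sub>C inv U f" for c f
    by (rule cinner_ext) (simp add: cinner_inv_right[OF U])
  have norm: "norm (inv U f) = norm f" for f
    by (metis U unitary_op_norm unitary_op_inv_right)
  have "cbounded_linear (inv U)"
    unfolding cbounded_linear_def
    by (intro conjI allI bounded_linear_intro[of _ 1]) (simp_all add: add scale norm scaleR_scaleC)
  then show ?thesis
    using bij_is_surj[OF bij_imp_bij_inv[OF unitary_op_bij[OF U]]]
    by (simp add: unitary_op_def cinner_inv_left[OF U] unitary_op_inv_right[OF U])
qed

lemma cadjoint_unitary:
  assumes U: "unitary_op U"
  shows "cadjoint U = inv U"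
  unfolding cadjoint_def
proof (rule the_equality)
  fix T assume T: "\<forall>f g. cinner (U f) g = cinner f (T g)"
  show "T = inv U"
    by (rule ext, rule cinner_ext) (simp add: T[rule_format, symmetric] cinner_inv_right[OF U])
qed (simp add: cinner_inv_right[OF U])

lemma orthonormal_basis_image:
  assumes U: "unitary_op U" and B: "orthonormal_basis B"
  shows "orthonormal_basis (U ` B)"
  unfolding orthonormal_basis_def
proof (intro conjI ballI allI impI)
  fix b b' assume "b \<in> U ` B" "b' \<in> U ` B"
  then show "cinner b b' = (if b = b' then 1 else 0)"
    using onbD[OF B] by (auto simp: unitary_op_cinner[OF U] inj_eq[OF bij_is_inj[OF unitary_op_bij[OF U]]])
next
  fix f assume "\<forall>b\<in>U ` B. cinner b f = 0"
  then have "inv U f = 0" by (intro onb_complete[OF B]) (simp add: cinner_inv_right[OF U])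
  then show "f = 0" by (metis U norm_eq_zero unitary_op_inv unitary_op_norm)
qed

lemma has_sum_unitary_image:
  assumes "unitary_op U"
  shows "(f has_sum s) (U ` B) \<longleftrightarrow> ((\<lambda>b. f (U b)) has_sum s) B"
  using has_sum_reindex[OF inj_on_subset[OF bij_is_inj[OF unitary_op_bij[OF assms]]], of B f s]
  by (simp add: o_def)

section \<open>Weyl operators\<close>

text \<open>The graph of \<open>W\<close> is the closure of the span of the pairs \<open>(c *\<^sub>C expvec v, c *\<^sub>C e v)\<close>.\<close>

lemma isometry_extension:
  fixes e :: "complex ^ 'n::finite \<Rightarrow> 'n fock"
  assumes iso: "\<And>v w. cinner (e v) (e w) = cinner (expvec v) (expvec w)"
  obtains W where "cbounded_linear W" "\<And>f g. cinner (W f) (W g) = cinner f g"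
    "\<And>v. W (expvec v) = e v"
proof -
  \<comment> \<open>\<open>span\<close> is the real span; complex multiples are built into the
    generators so that it is a complex subspace.\<close>
  define gens where "gens = {(c *\<^sub>C expvec v, c *\<^sub>C e v) | c v. True}"
  define G where "G = closure (span gens)"
  have G_lim: "\<exists>x. (\<forall>n. x n \<in> span gens) \<and> x \<longlonglongrightarrow> p" if "p \<in> G" for p
    using that unfolding G_def closure_sequential by blast
  have G_I: "p \<in> G" if "\<And>n. x n \<in> span gens" "x \<longlonglongrightarrow> p" for x p
    using that unfolding G_def closure_sequential by blast
  have G_add: "(f + f', g + g') \<in> G" if fg: "(f, g) \<in> G" "(f', g') \<in> G" for f f' g g'
  proof -
    obtain x y where "\<forall>n. x n \<in> span gens" "x \<longlonglongrightarrow> (f, g)" "\<forall>n. y n \<in> span gens" "y \<longlonglongrightarrow> (f', g')"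
      using G_lim[OF fg(1)] G_lim[OF fg(2)] by auto
    then show ?thesis
      using G_I[of "\<lambda>n. x n + y n"] tendsto_add[of x "(f, g)" sequentially y "(f', g')"]
      by (simp add: span_add)
  qed
  have G_scale: "(c *\<^sub>C f, c *\<^sub>C g) \<in> G" if fg: "(f, g) \<in> G" for c f g
  proof -
    let ?s = "\<lambda>p. (c *\<^sub>C fst p, c *\<^sub>C snd p)"
    have s_linear: "?s 0 = 0" "?s (p + q) = ?s p + ?s q" "?s (r *\<^sub>R p) = r *\<^sub>R ?s p" for p q r
      by (auto intro!: prod_eqI simp: scaleC_add_right scaleR_scaleC mult.commute)
    have span: "?s p \<in> span gens" if "p \<in> span gens" for p
      using that
    proof (induction p rule: span_induct)
      case base
      show ?case
        unfolding subspace_def mem_Collect_eq s_linear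
        by (intro conjI allI ballI impI span_zero span_add span_scale) simp_all
    next
      case (step p)
      then obtain d v where p: "p = (d *\<^sub>C expvec v, d *\<^sub>C e v)" by (auto simp: gens_def)
      have "((c * d) *\<^sub>C expvec v, (c * d) *\<^sub>C e v) \<in> gens" by (auto simp: gens_def)
      then show ?case by (simp add: p span_base)
    qed
    obtain x where x: "\<forall>n. x n \<in> span gens" "x \<longlonglongrightarrow> (f, g)" using G_lim[OF fg] by auto
    have "(\<lambda>n. ?s (x n)) \<longlonglongrightarrow> ?s (f, g)"
      by (intro tendsto_Pair bounded_linear.tendsto[OF bounded_linear_scaleC] tendsto_fst tendsto_snd x)
    then show ?thesis using G_I[of "\<lambda>n. ?s (x n)"] span x by simp
  qed
  have G_diff: "(f - f', g - g') \<in> G" if fg: "(f, g) \<in> G" "(f', g') \<in> G" for f f' g g'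
    using G_add[OF fg(1) G_scale[OF fg(2), of "-1"]] by (simp add: minus_fock_def uminus_fock_def)
  have span_cinner: "cinner (fst p) (fst q) = cinner (snd p) (snd q)"
    if p: "p \<in> span gens" and q: "q \<in> span gens" for p q
    using p
  proof (induction p rule: span_induct)
    case base
    show ?case by (auto simp: subspace_def cinner_add_left scaleR_scaleC)
  next
    case (step p)
    show ?case
      using q
    proof (induction q rule: span_induct)
      case base
      show ?case by (auto simp: subspace_def cinner_add_right scaleR_scaleC)
    qed (use step iso in \<open>auto simp: gens_def\<close>)
  qed
  have G_cinner: "cinner f f' = cinner g g'" if fg: "(f, g) \<in> G" "(f', g') \<in> G" for f f' g g'
  proof -
    obtain x y where x: "\<forall>n. x n \<in> span gens" "x \<longlonglongrightarrow> (f, g)"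
      and y: "\<forall>n. y n \<in> span gens" "y \<longlonglongrightarrow> (f', g')"
      using G_lim[OF fg(1)] G_lim[OF fg(2)] by auto
    have "(\<lambda>n. cinner (fst (x n)) (fst (y n))) \<longlonglongrightarrow> cinner f f'"
      "(\<lambda>n. cinner (snd (x n)) (snd (y n))) \<longlonglongrightarrow> cinner g g'"
      using tendsto_fst[OF x(2)] tendsto_fst[OF y(2)] tendsto_snd[OF x(2)] tendsto_snd[OF y(2)]
      by (auto intro: tendsto_cinner)
    moreover have "cinner (fst (x n)) (fst (y n)) = cinner (snd (x n)) (snd (y n))" for n
      using span_cinner x y by blast
    ultimately show ?thesis using LIMSEQ_unique by auto
  qed
  have G_norm: "norm f = norm g" if "(f, g) \<in> G" for f g
    using G_cinner[OF that that] unfolding cinner_self by (simp only: of_real_eq_iff) simp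
  have G_unique: "g = g'" if "(f, g) \<in> G" "(f, g') \<in> G" for f g g'
    using G_norm[OF G_diff[OF that]] by simp
  \<comment> \<open>The domain of the graph is closed: the graph is isometric, so convergent
    arguments have Cauchy values, and \<open>G\<close> is itself closed.\<close>
  have "\<exists>g. (f, g) \<in> G" for f
  proof (induction f rule: expvec_dense)
    case closed
    show ?case unfolding closed_sequential_limits
    proof safe
      fix x :: "nat \<Rightarrow> 'n fock" and f
      assume "\<forall>n. x n \<in> {f. \<exists>g. (f, g) \<in> G}" and x: "x \<longlonglongrightarrow> f"
      then obtain y where y: "\<And>n. (x n, y n) \<in> G" by (simp, metis)
      have "dist (y m) (y n) = dist (x m) (x n)" for m n
        using G_norm[OF G_diff[OF y y]] by (simp add: dist_norm)
      then have "Cauchy y" using LIMSEQ_imp_Cauchy[OF x] by (simp add: Cauchy_def)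
      then obtain g where "y \<longlonglongrightarrow> g" using Cauchy_convergent convergent_def by blast
      then have "(\<lambda>n. (x n, y n)) \<longlonglongrightarrow> (f, g)" by (intro tendsto_Pair x)
      then have "(f, g) \<in> G"
        using closed_sequentially[of G "\<lambda>n. (x n, y n)"] y by (simp add: G_def)
      then show "\<exists>g. (f, g) \<in> G" by blast
    qed
  next
    case (exp v)
    have "(1 *\<^sub>C expvec v, 1 *\<^sub>C e v) \<in> gens" unfolding gens_def by blast
    then show ?case unfolding G_def using span_base closure_subset by (metis in_mono scaleC_one)
  qed (use G_add G_scale in blast)+
  then obtain W where W: "\<And>f. (f, W f) \<in> G" by metis
  show thesis
  proof (rule that)
    show "cinner (W f) (W g) = cinner f g" for f g using G_cinner[OF W W] by simp
    have add: "W (f + g) = W f + W g" for f g using G_unique[OF W G_add[OF W W]] .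
    have scale: "W (c *\<^sub>C f) = c *\<^sub>C W f" for c f using G_unique[OF W G_scale[OF W]] .
    show "cbounded_linear W"
      unfolding cbounded_linear_def
      by (intro conjI allI bounded_linear_intro[of _ 1])
         (simp_all add: add scale scaleR_scaleC G_norm[OF W, symmetric])
    fix v
    have "(1 *\<^sub>C expvec v, 1 *\<^sub>C e v) \<in> gens" unfolding gens_def by blast
    then have "(expvec v, e v) \<in> G" unfolding G_def using span_base closure_subset by (metis in_mono scaleC_one)
    then show "W (expvec v) = e v" using G_unique[OF W] by blast
  qed
qed

lemma cdot_add_left: "cdot (u + v) w = cdot u w + cdot v w"
  and cdot_add_right: "cdot w (u + v) = cdot w u + cdot w v"
  and cdot_minus_left [simp]: "cdot (- u) w = - cdot u w"
  and cdot_minus_right [simp]: "cdot w (- u) = - cdot w u"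
  by (simp_all add: cdot_def algebra_simps sum.distrib sum_negf)

lemma cdot_commute: "cdot v u = cnj (cdot u v)"
  by (simp add: cdot_def mult.commute)

lemma cdot_self: "cdot u u = complex_of_real ((norm u)\<^sup>2)"
  by (simp add: cdot_def norm_vec_def L2_set_def sum_nonneg cnj_mult_self)

definition weyl_factor :: "complex ^ 'n \<Rightarrow> complex ^ 'n \<Rightarrow> complex" where
  "weyl_factor u v = exp (- (complex_of_real ((norm u)\<^sup>2) / 2) - cdot u v)"

text \<open>The scalar factor makes the inner products of the image vectors agree with those of the
  exponential vectors, so an isometry exists. It is onto because the isometries for \<open>u\<close>
  and \<open>- u\<close> compose to the identity on exponential vectors.\<close>

lemma weyl_ex1:
  fixes u :: "complex ^ 'n::finite"
  shows "\<exists>!W. unitary_op W \<and> (\<forall>v. W (expvec v) = weyl_factor u v *\<^sub>C expvec (u + v))"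
proof -
  have iso: "cinner (weyl_factor u v *\<^sub>C expvec (u + v)) (weyl_factor u w *\<^sub>C expvec (u + w))
      = cinner (expvec v) (expvec w)" for u v w :: "complex ^ 'n"
  proof -
    have "cnj (weyl_factor u v) * (weyl_factor u w * exp (cdot (u + v) (u + w))) = exp (cdot v w)"
      unfolding weyl_factor_def exp_cnj exp_add[symmetric]
      by (intro arg_cong[where f = exp])
         (simp add: cdot_add_left cdot_add_right cdot_self cdot_commute[of v u])
    then show ?thesis by (simp add: cinner_expvec mult_ac)
  qed
  have "\<exists>W. cbounded_linear W \<and> (\<forall>f g. cinner (W f) (W g) = cinner f g) \<and>
      (\<forall>v. W (expvec v) = weyl_factor u v *\<^sub>C expvec (u + v))" for u :: "complex ^ 'n"
    by (rule isometry_extension[OF iso[of u]]) blast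
  then obtain W where W: "\<And>u::complex ^ 'n. cbounded_linear (W u)"
    "\<And>u f g. cinner (W u f) (W u g) = cinner f g"
    "\<And>u v. W u (expvec v) = weyl_factor u v *\<^sub>C expvec (u + v)"
    by metis
  have "W u \<circ> W (- u) = id"
  proof (rule cbounded_linear_eqI[OF cbounded_linear_compose[OF W(1) W(1)]])
    fix v
    have "weyl_factor (- u) v * weyl_factor u (- u + v) = exp 0"
      unfolding weyl_factor_def exp_add[symmetric]
      by (intro arg_cong[where f = exp]) (simp add: cdot_add_right cdot_self del: add_uminus_conv_diff uminus_add_conv_diff)
    then show "(W u \<circ> W (- u)) (expvec v) = id (expvec v)"
      by (simp add: W(3) cbounded_linearD(2)[OF W(1)])
  qed (rule unitary_op_cbounded[OF unitary_op_id])
  then have "surj (W u)" by (metis comp_apply id_apply surjI)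
  then have "unitary_op (W u)" using W by (simp add: unitary_op_def)
  with W(3) show ?thesis
    by (intro ex1I[of _ "W u"]) (auto intro!: cbounded_linear_eqI intro: unitary_op_cbounded)
qed

lemma weyl_unitary: "unitary_op (weyl u)"
  and weyl_expvec: "weyl u (expvec v) = weyl_factor u v *\<^sub>C expvec (u + v)"
  for u :: "complex ^ 'n::finite"
  using theI'[OF weyl_ex1[of u]] unfolding weyl_def weyl_factor_def by blast+

text \<open>The Weyl form of the canonical commutation relations, with phase exp(2 i Im <u|z>). It
  follows by comparing exponents on exponential vectors, and it is the source of the shift of the
  mean under displacements.\<close>

lemma weyl_commutation: "weyl z \<circ> weyl u = (\<lambda>f. exp (cdot u z - cdot z u) *\<^sub>C (weyl u \<circ> weyl z) f)"
  for u :: "complex ^ 'n::finite"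
proof (rule cbounded_linear_eqI)
  fix v
  have "weyl_factor u v * weyl_factor z (u + v)
      = exp (cdot u z - cdot z u) * (weyl_factor z v * weyl_factor u (z + v))"
    unfolding weyl_factor_def exp_add[symmetric]
    by (intro arg_cong[where f = exp]) (simp add: cdot_add_right)
  then show "(weyl z \<circ> weyl u) (expvec v) = exp (cdot u z - cdot z u) *\<^sub>C (weyl u \<circ> weyl z) (expvec v)"
    by (simp add: weyl_expvec cbounded_linearD(2)[OF unitary_op_cbounded[OF weyl_unitary]] add_ac)
qed (intro cbounded_linear_scale cbounded_linear_compose unitary_op_cbounded weyl_unitary)+

text \<open>Strong continuity, needed for the measurability of Gaussian averages. It passes to
  limits in \<open>f\<close> because all \<open>weyl u\<close> are isometries: the convergence is
  uniform in \<open>u\<close>.\<close>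

lemma continuous_on_weyl: "continuous_on UNIV (\<lambda>u. weyl u f)" for f :: "'n::finite fock"
proof (induction f rule: expvec_dense)
  case closed
  show ?case unfolding closed_sequential_limits
  proof safe
    fix x :: "nat \<Rightarrow> 'n fock" and f
    assume x: "\<forall>n. x n \<in> {f. continuous_on UNIV (\<lambda>u. weyl u f)}" "x \<longlonglongrightarrow> f"
    have lim: "uniform_limit UNIV (\<lambda>n u. weyl u (x n)) (\<lambda>u. weyl u f) sequentially"
    proof (rule uniform_limitI)
      fix e :: real assume "e > 0"
      have "dist (weyl u (x n)) (weyl u f) = dist (x n) f" for u n
        using unitary_op_norm[OF weyl_unitary, of u "x n - f"]
          linear_diff[OF bounded_linear.linear[OF cbounded_linearD(1)[OF unitary_op_cbounded[OF weyl_unitary]]], of u]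
        by (simp add: dist_norm)
      then show "\<forall>\<^sub>F n in sequentially. \<forall>u\<in>UNIV. dist (weyl u (x n)) (weyl u f) < e"
        using tendstoD[OF x(2) \<open>e > 0\<close>] by simp
    qed
    show "continuous_on UNIV (\<lambda>u. weyl u f)"
      using x(1) by (intro uniform_limit_theorem[OF _ lim]) simp_all
  qed
next
  case (add f g)
  then show ?case
    by (simp add: cbounded_linear_add[OF unitary_op_cbounded[OF weyl_unitary]] continuous_on_add)
next
  case (scale c f)
  then show ?case
    by (simp add: cbounded_linearD(2)[OF unitary_op_cbounded[OF weyl_unitary]]
        bounded_linear.continuous_on[OF bounded_linear_scaleC])
next
  case (exp v)
  have "continuous_on UNIV (\<lambda>u. weyl_factor u v)"
    unfolding weyl_factor_def by (intro continuous_intros) auto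
  moreover have "continuous_on UNIV (\<lambda>u. expvec (u + v))"
    by (rule continuous_on_compose2[OF continuous_on_expvec]) (auto intro!: continuous_intros)
  ultimately show ?case
    unfolding weyl_expvec by (rule bounded_bilinear.continuous_on[OF bounded_bilinear_scaleC])
qed

section \<open>Attenuation of one mode\<close>

text \<open>This is s^(N_i). For \<open>s\<close> outside [-1, 1] the multiplication would be
  unbounded; the value 0 there keeps the map everywhere defined.\<close>

lift_definition mode_scale :: "'n \<Rightarrow> real \<Rightarrow> 'n fock \<Rightarrow> 'n fock"
  is "\<lambda>i s f xs. if \<bar>s\<bar> \<le> 1 then complex_of_real (s ^ count (mset xs) i) * f xs else 0"
proof
  fix i and s :: real and f :: "'n list \<Rightarrow> complex"
  let ?g = "\<lambda>xs. if \<bar>s\<bar> \<le> 1 then complex_of_real (s ^ count (mset xs) i) * f xs else 0"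
  assume f: "(\<forall>xs ys. mset xs = mset ys \<longrightarrow> f xs = f ys) \<and> (\<lambda>xs. (cmod (f xs))\<^sup>2) summable_on UNIV"
  then show "\<forall>xs ys. mset xs = mset ys \<longrightarrow> ?g xs = ?g ys" by metis
  have "cmod (?g xs) \<le> cmod (f xs)" for xs
    by (simp add: norm_mult norm_power power_le_one mult_left_le_one_le)
  then show "(\<lambda>xs. (cmod (?g xs))\<^sup>2) summable_on UNIV"
    by (intro summable_on_comparison_test[OF f[THEN conjunct2]] power_mono) simp_all
qed

lemma mode_scale_cbounded: "cbounded_linear (mode_scale i s)"
proof -
  have add: "mode_scale i s (f + g) = mode_scale i s f + mode_scale i s g" for f g
    by (rule fock_ext) (simp add: mode_scale.rep_eq amp_simps distrib_left)
  have scale: "mode_scale i s (c *\<^sub>C f) = c *\<^sub>C mode_scale i s f" for c f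
    by (rule fock_ext) (simp add: mode_scale.rep_eq amp_simps)
  have "norm (mode_scale i s f) \<le> 1 * norm f" for f
    by (rule norm_fock_mono)
       (simp_all add: mode_scale.rep_eq norm_mult norm_power power_le_one mult_left_le_one_le)
  then show ?thesis unfolding cbounded_linear_def
    by (intro conjI allI bounded_linear_intro[of _ 1]) (simp_all add: add scale scaleR_scaleC)
qed

lemma mode_scale_nvec: "\<bar>s\<bar> \<le> 1 \<Longrightarrow> mode_scale i s (nvec A) = complex_of_real (s ^ count A i) *\<^sub>C nvec A"
  by (rule fock_ext) (simp add: mode_scale.rep_eq amp_simps nvec.rep_eq)

lemma mode_scale_expvec:
  assumes "\<bar>s\<bar> \<le> 1"
  shows "mode_scale i s (expvec v) = expvec (\<chi> j. if j = i then of_real s * v $ j else v $ j)"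
proof (rule fock_ext)
  fix xs :: "'a list"
  have "(\<Prod>j\<in>UNIV. (if j = i then of_real s * v $ j else v $ j) ^ count (mset xs) j)
      = (\<Prod>j\<in>UNIV. (if j = i then of_real s ^ count (mset xs) i else 1) * v $ j ^ count (mset xs) j)"
    by (intro prod.cong) (auto simp: power_mult_distrib)
  also have "\<dots> = of_real s ^ count (mset xs) i * (\<Prod>j\<in>UNIV. v $ j ^ count (mset xs) j)"
    by (simp add: prod.distrib)
  finally show "amp (mode_scale i s (expvec v)) xs
      = amp (expvec (\<chi> j. if j = i then of_real s * v $ j else v $ j)) xs"
    using assms by (simp add: mode_scale.rep_eq expvec.rep_eq prod_list_count)
qed

section \<open>Gaussian averages of Weyl operators\<close>

text \<open>Completing the square with complex \<open>b\<close> would move the contour off the real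
  line. Instead the real part of \<open>b\<close> is absorbed by a real affine substitution, and the
  imaginary part by the characteristic function of the standard normal law.\<close>

lemma std_normal_exp_integral:
  fixes b :: complex
  assumes "\<sigma> > 0"
  shows "has_bochner_integral std_normal_distribution
    (\<lambda>x. exp (of_real (- \<sigma> * x\<^sup>2 / 2) + of_real (sqrt \<sigma> * x) * b))
    (of_real (1 / sqrt (1 + \<sigma>)) * exp (of_real (\<sigma> / (2 * (1 + \<sigma>))) * b\<^sup>2))"
proof -
  define p q where "p = Re b" and "q = Im b"
  define r where "r = sqrt \<sigma>"
  \<comment> \<open>After the weight exp(-\<sigma> x^2 / 2) and the real tilt, the normal law has
    deviation \<open>\<tau>\<close> and mean \<open>\<mu>\<close>; \<open>c\<close> is the frequency
    left in the rescaled variable, and \<open>K\<close> collects the constants.\<close>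
  define \<tau> where "\<tau> = 1 / sqrt (1 + \<sigma>)"
  define \<mu> where "\<mu> = r * p * \<tau>\<^sup>2"
  define c where "c = r * q * \<tau>"
  define K where "K = exp (Complex (\<sigma> * p\<^sup>2 * \<tau>\<^sup>2 / 2) (r * q * \<mu>))"
  let ?f = "\<lambda>x. exp (of_real (- \<sigma> * x\<^sup>2 / 2) + of_real (sqrt \<sigma> * x) * b)"
  let ?I = "of_real (1 / sqrt (1 + \<sigma>)) * exp (of_real (\<sigma> / (2 * (1 + \<sigma>))) * b\<^sup>2)"
  have r2: "r\<^sup>2 = \<sigma>" and \<tau>2: "(1 + \<sigma>) * \<tau>\<^sup>2 = 1" and \<tau>: "\<tau> > 0"
    using assms by (simp_all add: r_def \<tau>_def power_divide)
  have std: "std_normal_density x *\<^sub>R exp w = of_real (1 / sqrt (2 * pi)) * exp (of_real (- x\<^sup>2 / 2) + w)"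
    for x and w :: complex
    unfolding std_normal_density_def scaleR_conv_of_real of_real_mult exp_add exp_of_real by simp
  have shift: "std_normal_density (\<mu> + \<tau> * y) *\<^sub>R ?f (\<mu> + \<tau> * y)
      = K * (std_normal_density y *\<^sub>R iexp (c * y))" for y
  proof -
    define x where "x = \<mu> + \<tau> * y"
    have "(1 + \<sigma>) * x\<^sup>2 = ((1 + \<sigma>) * \<tau>\<^sup>2) * (y + r * p * \<tau>)\<^sup>2"
      unfolding x_def \<mu>_def by algebra
    then have x2: "x\<^sup>2 + \<sigma> * x\<^sup>2 = (y + r * p * \<tau>)\<^sup>2" unfolding \<tau>2 by (simp add: distrib_right)
    have "r * p * x = r * p * \<tau> * y + \<sigma> * p\<^sup>2 * \<tau>\<^sup>2"
      unfolding x_def \<mu>_def r2[symmetric] by algebra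
    then have "- x\<^sup>2 / 2 - \<sigma> * x\<^sup>2 / 2 + r * x * p = - y\<^sup>2 / 2 + \<sigma> * p\<^sup>2 * \<tau>\<^sup>2 / 2"
      using x2 r2 by (simp add: power2_sum power_mult_distrib algebra_simps)
    then have "of_real (- x\<^sup>2 / 2) + (of_real (- \<sigma> * x\<^sup>2 / 2) + of_real (sqrt \<sigma> * x) * b)
        = Complex (\<sigma> * p\<^sup>2 * \<tau>\<^sup>2 / 2) (r * q * \<mu>) + (of_real (- y\<^sup>2 / 2) + \<i> * of_real (c * y))"
      by (simp add: complex_eq_iff p_def q_def r_def c_def x_def algebra_simps)
    then show ?thesis
      unfolding x_def[symmetric] std K_def by (simp add: exp_add mult_ac)
  qed
  have "integrable std_normal_distribution (\<lambda>y. iexp (c * y))"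
    using real_dist_normal_dist
    by (intro prob_space.integrable_iexp) (auto simp: real_distribution_def)
  moreover have "(LINT y|std_normal_distribution. iexp (c * y)) = of_real (exp (- c\<^sup>2 / 2))"
    using fun_cong[OF char_std_normal_distribution, of c] by (simp add: char_def)
  ultimately have "has_bochner_integral std_normal_distribution (\<lambda>y. iexp (c * y)) (of_real (exp (- c\<^sup>2 / 2)))"
    by (simp add: has_bochner_integral_iff)
  then have "has_bochner_integral lborel (\<lambda>y. std_normal_density y *\<^sub>R iexp (c * y)) (of_real (exp (- c\<^sup>2 / 2)))"
    unfolding has_bochner_integral_iff
    by (subst (asm) integrable_density, simp, simp, simp, subst (asm) integral_density, simp, simp, simp) simp
  then have "has_bochner_integral lborel (\<lambda>y. K * (std_normal_density y *\<^sub>R iexp (c * y)))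
      (K * of_real (exp (- c\<^sup>2 / 2)))"
    by (intro has_bochner_integral_mult_right) auto
  moreover have "?I /\<^sub>R \<bar>\<tau>\<bar> = K * of_real (exp (- c\<^sup>2 / 2))"
  proof -
    have k: "\<sigma> / (2 * (1 + \<sigma>)) = \<sigma> * \<tau>\<^sup>2 / 2"
      using assms by (simp add: \<tau>_def power_divide)
    have "of_real (\<sigma> / (2 * (1 + \<sigma>))) * b\<^sup>2
        = Complex (\<sigma> * p\<^sup>2 * \<tau>\<^sup>2 / 2) (r * q * \<mu>) + of_real (- c\<^sup>2 / 2)"
      unfolding k unfolding r2[symmetric]
      by (simp add: complex_eq_iff p_def q_def c_def \<mu>_def power2_eq_square field_simps)
    then have "?I = of_real \<tau> * (K * of_real (exp (- c\<^sup>2 / 2)))"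
      by (simp only: exp_add exp_of_real K_def \<tau>_def)
    then show ?thesis using \<tau> by (simp add: scaleR_conv_of_real)
  qed
  ultimately have "has_bochner_integral lborel
      (\<lambda>y. std_normal_density (\<mu> + \<tau> * y) *\<^sub>R ?f (\<mu> + \<tau> * y)) (?I /\<^sub>R \<bar>\<tau>\<bar>)"
    by (simp only: shift)
  then have "has_bochner_integral lborel (\<lambda>x. std_normal_density x *\<^sub>R ?f x) ?I"
    by (rule iffD2[OF lborel_has_bochner_integral_real_affine_iff[of \<tau> _ _ \<mu>], rotated])
       (rule less_imp_neq[OF \<tau>, symmetric])
  then show ?thesis
    by (intro has_bochner_integral_density) auto
qed

section \<open>Averages over the standard normal law of the plane\<close>

lemma (in pair_sigma_finite) has_bochner_integral_product:
  fixes f g :: "_ \<Rightarrow> 'c::{real_normed_field, banach, second_countable_topology}"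
  assumes f: "has_bochner_integral M1 f a" and g: "has_bochner_integral M2 g b"
  shows "has_bochner_integral (M1 \<Otimes>\<^sub>M M2) (\<lambda>(x, y). f x * g y) (a * b)"
proof -
  have if': "integrable M1 f" "integrable M2 g" and eq: "integral\<^sup>L M1 f = a" "integral\<^sup>L M2 g = b"
    using f g by (simp_all add: has_bochner_integral_iff)
  have [measurable]: "f \<in> borel_measurable M1" "g \<in> borel_measurable M2" using if' by auto
  have int: "integrable (M1 \<Otimes>\<^sub>M M2) (\<lambda>(x, y). f x * g y)"
    by (rule Fubini_integrable) (use if' in \<open>auto simp: norm_mult\<close>)
  have "integral\<^sup>L (M1 \<Otimes>\<^sub>M M2) (\<lambda>(x, y). f x * g y) = a * b"
    using integral_fst'[OF int] by (simp add: if' eq)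
  with int show ?thesis by (simp add: has_bochner_integral_iff)
qed

definition gauss2 :: "(real \<times> real) measure" where
  "gauss2 = std_normal_distribution \<Otimes>\<^sub>M std_normal_distribution"

interpretation std_normal: real_distribution std_normal_distribution
  by (rule real_dist_normal_dist)

interpretation std_normal_pair: pair_prob_space std_normal_distribution std_normal_distribution
  by unfold_locales

lemma sets_gauss2 [measurable_cong]: "sets gauss2 = sets (borel \<Otimes>\<^sub>M borel)"
  unfolding gauss2_def by (intro sets_pair_measure_cong) auto

interpretation gauss2: prob_space gauss2
  unfolding gauss2_def by (rule std_normal_pair.prob_space_axioms)

lemma has_bochner_integral_gauss2:
  fixes f g :: "real \<Rightarrow> 'b::{real_normed_field, banach, second_countable_topology}"
  assumes "has_bochner_integral std_normal_distribution f a"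
    and "has_bochner_integral std_normal_distribution g b"
  shows "has_bochner_integral gauss2 (\<lambda>(x, y). f x * g y) (a * b)"
  unfolding gauss2_def by (rule std_normal_pair.has_bochner_integral_product[OF assms])

definition mode_vec :: "'n \<Rightarrow> real \<Rightarrow> real \<times> real \<Rightarrow> complex ^ 'n::finite" where
  "mode_vec i \<sigma> = (\<lambda>(x, y). axis i (Complex (sqrt \<sigma> * x) (sqrt \<sigma> * y)))"

lemma continuous_on_mode_vec: "continuous_on UNIV (mode_vec i \<sigma>)"
proof -
  have eq: "mode_vec i \<sigma> = (\<lambda>z. axis i (of_real (sqrt \<sigma> * fst z) + \<i> * of_real (sqrt \<sigma> * snd z)))"
    by (auto simp: mode_vec_def fun_eq_iff Complex_eq)
  have "continuous_on UNIV (\<lambda>z. \<chi> j. if j = i then of_real (sqrt \<sigma> * fst z) + \<i> * of_real (sqrt \<sigma> * snd z) else (0::complex))"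
    by (rule continuous_on_vec_lambda, case_tac "j = i") (auto intro!: continuous_intros)
  then show ?thesis unfolding eq axis_def .
qed

lemma cdot_axis_left [simp]: "cdot (axis i z) v = cnj z * v $ i"
  and cdot_axis_right [simp]: "cdot u (axis i z) = cnj (u $ i) * z"
  unfolding cdot_def axis_def
  by (simp_all add: if_distrib[of cnj] if_distrib[of "\<lambda>z. z * _"] if_distrib[of "\<lambda>z. _ * z"] cong: if_cong)

lemma integrable_weyl:
  "integrable gauss2 (\<lambda>z. cinner f (weyl (mode_vec i \<sigma> z) g))" for f :: "'n::finite fock"
proof (rule gauss2.integrable_const_bound)
  show "AE z in gauss2. norm (cinner f (weyl (mode_vec i \<sigma> z) g)) \<le> norm f * norm g"
    using norm_cinner_le[of f "weyl _ g"] by (simp add: unitary_op_norm[OF weyl_unitary])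
  have "continuous_on UNIV (\<lambda>z. cinner f (weyl (mode_vec i \<sigma> z) g))"
    by (intro continuous_on_cinner continuous_on_const
        continuous_on_compose2[OF continuous_on_weyl continuous_on_mode_vec]) auto
  then have "(\<lambda>z. cinner f (weyl (mode_vec i \<sigma> z) g)) \<in> borel_measurable borel"
    by (rule borel_measurable_continuous_onI)
  then show "(\<lambda>z. cinner f (weyl (mode_vec i \<sigma> z) g)) \<in> borel_measurable gauss2"
    by (simp add: measurable_cong_sets[OF sets_gauss2 refl] borel_prod)
qed

text \<open>The integrand factorises in the two real variables, with linear coefficients
  \<open>a\<close> and \<open>b\<close> in the exponents. Since a^2 + b^2 is -4 times the product of
  cnj(u_i) and v_i, and -4 \<sigma> / (2 (1 + \<sigma>)) = s - 1, the average replaces v_i by s v_i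
  in <u|v>.\<close>

lemma integral_weyl_expvec:
  fixes u v :: "complex ^ 'n::finite"
  assumes "\<sigma> > 0"
  shows "(LINT z|gauss2. cinner (expvec u) (weyl (mode_vec i \<sigma> z) (expvec v)))
    = cinner (expvec u) (mode_scale i ((1 - \<sigma>) / (1 + \<sigma>)) (expvec v)) / of_real (1 + \<sigma>)"
proof -
  define s where "s = (1 - \<sigma>) / (1 + \<sigma>)"
  define a b where "a = cnj (u $ i) - v $ i" and "b = \<i> * (cnj (u $ i) + v $ i)"
  let ?f = "\<lambda>b x. exp (of_real (- \<sigma> * x\<^sup>2 / 2) + of_real (sqrt \<sigma> * x) * b)"
  let ?I = "\<lambda>b. of_real (1 / sqrt (1 + \<sigma>)) * exp (of_real (\<sigma> / (2 * (1 + \<sigma>))) * b\<^sup>2)"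
  have "\<bar>s\<bar> \<le> 1" using assms by (auto simp: s_def abs_le_iff field_simps)
  have integrand: "cinner (expvec u) (weyl (mode_vec i \<sigma> z) (expvec v))
      = exp (cdot u v) * (case z of (x, y) \<Rightarrow> ?f a x * ?f b y)" for z
  proof (cases z)
    case (Pair x y)
    let ?c = "Complex (sqrt \<sigma> * x) (sqrt \<sigma> * y)"
    have "(norm (axis i ?c :: complex ^ 'n))\<^sup>2 = \<sigma> * x\<^sup>2 + \<sigma> * y\<^sup>2"
      using assms cdot_self[of "axis i ?c :: complex ^ 'n"]
      by (simp add: complex_eq_iff power2_eq_square algebra_simps flip: of_real_power)
    then have "- (complex_of_real ((norm (axis i ?c :: complex ^ 'n))\<^sup>2) / 2) - cdot (axis i ?c) v + cdot u (axis i ?c + v)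
        = cdot u v + ((of_real (- \<sigma> * x\<^sup>2 / 2) + of_real (sqrt \<sigma> * x) * a)
          + (of_real (- \<sigma> * y\<^sup>2 / 2) + of_real (sqrt \<sigma> * y) * b))"
      by (simp add: cdot_add_right a_def b_def Complex_eq algebra_simps add_divide_distrib)
    then show ?thesis
      by (simp add: Pair mode_vec_def weyl_expvec weyl_factor_def cinner_expvec flip: exp_add)
  qed
  have "has_bochner_integral gauss2 (\<lambda>(x, y). ?f a x * ?f b y) (?I a * ?I b)"
    by (intro has_bochner_integral_gauss2 std_normal_exp_integral assms)
  then have "(LINT z|gauss2. cinner (expvec u) (weyl (mode_vec i \<sigma> z) (expvec v))) = exp (cdot u v) * (?I a * ?I b)"
    unfolding integrand by (simp add: has_bochner_integral_iff)
  also have "\<dots> = exp (cdot u v + of_real (\<sigma> / (2 * (1 + \<sigma>))) * (a\<^sup>2 + b\<^sup>2)) / of_real (1 + \<sigma>)"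
  proof -
    define T where "T = complex_of_real (1 / sqrt (1 + \<sigma>))"
    have T: "T * T = 1 / of_real (1 + \<sigma>)"
      unfolding T_def using assms by (simp flip: of_real_mult)
    have "exp w * ((T * exp (k * a\<^sup>2)) * (T * exp (k * b\<^sup>2))) = exp (w + k * (a\<^sup>2 + b\<^sup>2)) / of_real (1 + \<sigma>)" for w k
    proof -
      have "exp w * ((T * exp (k * a\<^sup>2)) * (T * exp (k * b\<^sup>2))) = (T * T) * (exp w * (exp (k * a\<^sup>2) * exp (k * b\<^sup>2)))"
        by (simp only: mult_ac)
      also have "exp w * (exp (k * a\<^sup>2) * exp (k * b\<^sup>2)) = exp (w + k * (a\<^sup>2 + b\<^sup>2))"
        by (simp only: exp_add[symmetric] distrib_left)
      finally show ?thesis unfolding T by simp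
    qed
    then show ?thesis unfolding T_def .
  qed
  also have "a\<^sup>2 + b\<^sup>2 = - 4 * (cnj (u $ i) * v $ i)"
    unfolding a_def b_def by (simp add: power_mult_distrib) algebra
  also have "cdot u v + of_real (\<sigma> / (2 * (1 + \<sigma>))) * (- 4 * (cnj (u $ i) * v $ i))
      = cdot u (\<chi> j. if j = i then of_real s * v $ j else v $ j)"
  proof -
    have "\<sigma> / (2 * (1 + \<sigma>)) * (- 4) = s - 1"
      using assms by (simp add: s_def field_simps)
    then have "complex_of_real (\<sigma> / (2 * (1 + \<sigma>))) * (- 4) = of_real (s - 1)"
      by (metis of_real_mult of_real_minus of_real_numeral)
    then have "of_real (\<sigma> / (2 * (1 + \<sigma>))) * (- 4 * (cnj (u $ i) * v $ i))
        = of_real (s - 1) * (cnj (u $ i) * v $ i)"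
      by (metis mult.assoc)
    also have "\<dots> = (\<Sum>j\<in>UNIV. if j = i then of_real (s - 1) * (cnj (u $ j) * v $ j) else 0)"
      by simp
    finally have 1: "of_real (\<sigma> / (2 * (1 + \<sigma>))) * (- 4 * (cnj (u $ i) * v $ i))
        = (\<Sum>j\<in>UNIV. if j = i then of_real (s - 1) * (cnj (u $ j) * v $ j) else 0)" .
    have "cdot u (\<chi> j. if j = i then of_real s * v $ j else v $ j)
        = (\<Sum>j\<in>UNIV. cnj (u $ j) * v $ j + (if j = i then of_real (s - 1) * (cnj (u $ j) * v $ j) else 0))"
      unfolding cdot_def by (intro sum.cong refl) (simp add: algebra_simps)
    then show ?thesis unfolding 1 by (simp only: sum.distrib cdot_def)
  qed
  finally show ?thesis
    using \<open>\<bar>s\<bar> \<le> 1\<close> by (simp add: s_def[symmetric] mode_scale_expvec cinner_expvec)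
qed

text \<open>Both sides are additive, continuous and compatible with scalars in each argument, the
  integral because unitarity bounds it by \<open>norm f * norm g\<close>. Totality of exponential
  vectors is used once per argument; only scalar integrals occur.\<close>

lemma integral_weyl:
  fixes f g :: "'n::finite fock"
  assumes "\<sigma> > 0"
  shows "(LINT z|gauss2. cinner f (weyl (mode_vec i \<sigma> z) g))
    = cinner f (mode_scale i ((1 - \<sigma>) / (1 + \<sigma>)) g) / of_real (1 + \<sigma>)"
proof -
  let ?W = "\<lambda>z. weyl (mode_vec i \<sigma> z)" and ?D = "mode_scale i ((1 - \<sigma>) / (1 + \<sigma>))"
  let ?L = "\<lambda>f g. LINT z|gauss2. cinner f (?W z g)"
  note W = unitary_op_cbounded[OF weyl_unitary]
  note int = integrable_weyl[of _ i \<sigma>]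
  have L_add: "?L f (g + h) = ?L f g + ?L f h" "?L (f + h) g = ?L f g + ?L h g"
    and L_scale: "?L f (c *\<^sub>C g) = c * ?L f g" "?L (c *\<^sub>C f) g = cnj c * ?L f g" for f g h c
    by (simp_all add: cbounded_linear_add[OF W] cbounded_linearD(2)[OF W] cinner_add_left cinner_add_right int)
  have L_bound: "cmod (?L f g) \<le> norm f * norm g" for f g
  proof -
    have "cmod (?L f g) \<le> (LINT z|gauss2. norm f * norm g)"
    proof (rule Bochner_Integration.integral_norm_bound_integral[OF int])
      show "cmod (cinner f (?W z g)) \<le> norm f * norm g" for z
        using norm_cinner_le[of f "?W z g"] by (simp add: unitary_op_norm[OF weyl_unitary])
    qed simp
    then show ?thesis by (simp add: gauss2.prob_space)
  qed
  have BL: "bounded_linear (?L f)" "bounded_linear (\<lambda>f. ?L f g)" for f g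
    using L_bound[of f] L_bound[of _ g]
    by (intro bounded_linear_intro[of _ "norm f"] bounded_linear_intro[of _ "norm g"];
        simp only: L_add L_scale scaleR_scaleC scaleR_conv_of_real mult.commute complex_cnj_complex_of_real)+
  have cont: "continuous_on UNIV (\<lambda>g. cinner f (?D g) / of_real (1 + \<sigma>))"
    "continuous_on UNIV (\<lambda>f. cinner f (?D g) / of_real (1 + \<sigma>))" for f g
    using assms linear_continuous_on[OF cbounded_linearD(1)[OF mode_scale_cbounded]]
    by (auto intro!: continuous_intros simp: complex_eq_iff)
  have 1: "?L (expvec u) g = cinner (expvec u) (?D g) / of_real (1 + \<sigma>)" for u
  proof (induction g rule: expvec_dense)
    case closed
    show ?case by (intro closed_Collect_eq linear_continuous_on BL cont)
  next
    case (add f g)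
    then show ?case by (simp add: L_add cbounded_linear_add[OF mode_scale_cbounded] cinner_add_right add_divide_distrib)
  next
    case (scale c f)
    then show ?case by (simp add: L_scale cbounded_linearD(2)[OF mode_scale_cbounded])
  next
    case (exp v)
    show ?case by (rule integral_weyl_expvec[OF assms])
  qed
  show ?thesis
  proof (induction f rule: expvec_dense)
    case closed
    show ?case by (intro closed_Collect_eq linear_continuous_on BL cont)
  next
    case (add f g)
    then show ?case unfolding mem_Collect_eq L_add(2) by (simp add: cinner_add_left add_divide_distrib)
  next
    case (scale c f)
    then show ?case by (simp add: L_scale)
  next
    case (exp v)
    show ?case by (rule 1)
  qed
qed

section \<open>States and traces\<close>

lemma positive_opD:
  assumes "positive_op \<rho>"
  shows "cbounded_linear \<rho>" "Im (cinner f (\<rho> f)) = 0" "Re (cinner f (\<rho> f)) \<ge> 0"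
  using assms complex_nonneg_Reals_iff unfolding positive_op_def by auto

text \<open>Polarisation: the form is real at \<open>f + g\<close> and at
  \<open>f + \<i> *\<^sub>C g\<close>.\<close>

lemma positive_op_hermitian:
  assumes "positive_op \<rho>"
  shows "cinner f (\<rho> g) = cinner (\<rho> f) g"
proof -
  note T = positive_opD(1)[OF assms]
  note lin = cbounded_linear_add[OF T] cbounded_linearD(2)[OF T] cinner_add_left cinner_add_right
  have "Im (cinner f (\<rho> g) + cinner g (\<rho> f)) = 0"
    using positive_opD(2)[OF assms, of "f + g"] positive_opD(2)[OF assms] by (simp add: lin)
  moreover have "Re (cinner f (\<rho> g) - cinner g (\<rho> f)) = 0"
    using positive_opD(2)[OF assms, of "f + \<i> *\<^sub>C g"] positive_opD(2)[OF assms] by (simp add: lin)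
  ultimately have "cinner f (\<rho> g) = cnj (cinner g (\<rho> f))" by (simp add: complex_eq_iff)
  then show ?thesis by (simp add: cinner_commute[of "\<rho> f"])
qed

lemma positive_op_Cauchy_Schwarz:
  assumes "positive_op \<rho>"
  shows "cmod (cinner f (\<rho> g)) \<le> sqrt (Re (cinner f (\<rho> f))) * sqrt (Re (cinner g (\<rho> g)))"
proof (cases "cinner f (\<rho> g) = 0")
  case True
  then show ?thesis using positive_opD(3)[OF assms] by simp
next
  case False
  note T = positive_opD(1)[OF assms]
  note lin = cbounded_linear_add[OF T] cbounded_linearD(2)[OF T] cinner_add_left cinner_add_right
  define a b c where "a = Re (cinner f (\<rho> f))" and "b = Re (cinner g (\<rho> g))" and "c = cmod (cinner f (\<rho> g))"
  have pos: "a \<ge> 0" "b \<ge> 0" "c > 0" using positive_opD(3)[OF assms] False by (auto simp: a_def b_def c_def)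
  have quad: "0 \<le> a - 2 * t * c + t\<^sup>2 * b" for t :: real
  proof -
    \<comment> \<open>A phase that makes the mixed term real, so that positivity at f - t d g is a
      real quadratic inequality in \<open>t\<close>.\<close>
    define d where "d = cnj (cinner f (\<rho> g)) / of_real c"
    have d: "d * cinner f (\<rho> g) = of_real c" "cnj d * d = 1"
      using False by (simp_all add: d_def c_def cnj_mult_self mult_cnj_self power2_eq_square)
    have d': "cnj d * cinner g (\<rho> f) = of_real c"
      using arg_cong[OF d(1), of cnj]
      by (simp add: positive_op_hermitian[OF assms, of f g] cinner_commute[of g "\<rho> f"])
    have "cinner (f + (- t * d) *\<^sub>C g) (\<rho> (f + (- t * d) *\<^sub>C g))
        = cinner f (\<rho> f) - t * (d * cinner f (\<rho> g)) - t * (cnj d * cinner g (\<rho> f))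
          + t\<^sup>2 * ((cnj d * d) * cinner g (\<rho> g))"
      by (simp add: lin power2_eq_square algebra_simps)
    then have "Re (cinner (f + (- t * d) *\<^sub>C g) (\<rho> (f + (- t * d) *\<^sub>C g))) = a - 2 * t * c + t\<^sup>2 * b"
      unfolding d d' by (simp add: a_def b_def)
    then show ?thesis using positive_opD(3)[OF assms] by metis
  qed
  have "c\<^sup>2 \<le> a * b"
  proof (cases "b = 0")
    case True
    \<comment> \<open>The form may be degenerate. For b = 0 the quadratic is affine in
      \<open>t\<close>, and this \<open>t\<close> would give it the value -1.\<close>
    then show ?thesis using quad[of "(a + 1) / (2 * c)"] pos by simp
  next
    case False
    then have "b > 0" using pos by simp
    then have "0 \<le> b * (a - 2 * (c / b) * c + (c / b)\<^sup>2 * b)"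
      using quad[of "c / b"] by (intro mult_nonneg_nonneg) auto
    then show ?thesis using \<open>b > 0\<close> by (simp add: field_simps power2_eq_square)
  qed
  then have "c \<le> sqrt (a * b)" by (rule real_le_rsqrt)
  then show ?thesis by (simp add: a_def b_def c_def real_sqrt_mult)
qed

lemma has_op_traceD:
  "has_op_trace T t \<Longrightarrow> orthonormal_basis B \<Longrightarrow> ((\<lambda>b. cinner b (T b)) has_sum t) B"
  unfolding has_op_trace_def by blast

text \<open>Uniqueness of the trace rests on the existence of some orthonormal basis, here the
  occupation number basis.\<close>

lemma op_trace_eq: "has_op_trace T t \<Longrightarrow> op_trace T = t"
  for T :: "'n::finite fock \<Rightarrow> 'n fock"
  unfolding op_trace_def
  by (rule the_equality, assumption) (metis has_op_traceD onb_nvec has_sum_unique)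

lemma has_op_trace_nvec:
  assumes "has_op_trace T t" "unitary_op U"
  shows "((\<lambda>A. cinner (U (nvec A)) (T (U (nvec A)))) has_sum t) UNIV"
  using has_op_traceD[OF assms(1) orthonormal_basis_image[OF assms(2) onb_nvec]]
  by (simp only: has_sum_unitary_image[OF assms(2)] has_sum_nvec_iff)

text \<open>A rank-one term contributes <g|b><b|h> at the basis vector b, and Parseval sums this to
  <g|h> along every basis.\<close>

lemma has_op_trace_finite_rank:
  assumes "cbounded_linear T" and T: "\<And>f. T f = (\<Sum>i\<in>I. cinner (g i) f *\<^sub>C h i)"
  shows "has_op_trace T (\<Sum>i\<in>I. cinner (g i) (h i))"
proof -
  have "((\<lambda>b. \<Sum>i\<in>I. cinner (g i) b * cinner b (h i)) has_sum (\<Sum>i\<in>I. cinner (g i) (h i))) B"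
    if "orthonormal_basis B" for B
    by (induction I rule: infinite_finite_induct) (auto intro!: has_sum_add parseval that)
  then show ?thesis
    unfolding has_op_trace_def using assms(1) by (simp add: T cinner_sum_right)
qed

lemma cbounded_linear_number_proj: "cbounded_linear (number_proj k)"
proof -
  have add: "number_proj k (f + g) = number_proj k f + number_proj k g" for f g :: "'n fock"
    by (rule fock_ext) (simp add: number_proj.rep_eq amp_simps)
  have scale: "number_proj k (c *\<^sub>C f) = c *\<^sub>C number_proj k f" for c and f :: "'n fock"
    by (rule fock_ext) (simp add: number_proj.rep_eq amp_simps)
  have "norm (number_proj k f) \<le> 1 * norm f" for f :: "'n fock"
  proof (rule power2_le_imp_le)
    have "(norm (number_proj k f))\<^sup>2 \<le> (norm f)\<^sup>2"
      unfolding norm_fock_sq by (intro infsum_mono amp_summable) (simp add: number_proj.rep_eq)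
    then show "(norm (number_proj k f))\<^sup>2 \<le> (1 * norm f)\<^sup>2" by simp
  qed simp
  then show ?thesis unfolding cbounded_linear_def
    by (intro conjI allI bounded_linear_intro[of _ 1]) (simp_all add: add scale scaleR_scaleC)
qed

section \<open>Occupation probabilities and truncated traces\<close>

definition occupation :: "('n::finite fock \<Rightarrow> 'n fock) \<Rightarrow> 'n multiset \<Rightarrow> real" where
  "occupation \<rho> A = Re (cinner (nvec A) (\<rho> (nvec A)))"

lemma occupation_nonneg: "state \<rho> \<Longrightarrow> occupation \<rho> A \<ge> 0"
  by (simp add: occupation_def state_def positive_opD)

lemma occupation_complex: "state \<rho> \<Longrightarrow> cinner (nvec A) (\<rho> (nvec A)) = of_real (occupation \<rho> A)"
  using positive_opD(2)[of \<rho> "nvec A"] by (simp add: occupation_def state_def complex_eq_iff)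

lemma state_has_sum:
  assumes "state \<rho>" "unitary_op U"
  shows "((\<lambda>A. Re (cinner (U (nvec A)) (\<rho> (U (nvec A))))) has_sum 1) UNIV"
  using has_sum_Re[OF has_op_trace_nvec[OF _ assms(2), of \<rho> 1]] assms(1) by (simp add: state_def)

lemma occupation_has_sum: "state \<rho> \<Longrightarrow> (occupation \<rho> has_sum 1) UNIV"
  using state_has_sum[OF _ unitary_op_id] by (simp add: occupation_def[abs_def])

lemma occupation_sum_le: "state \<rho> \<Longrightarrow> finite F \<Longrightarrow> sum (occupation \<rho>) F \<le> 1"
  using finite_sum_le_has_sum[OF occupation_has_sum] occupation_nonneg by blast

text \<open>Uniformity in \<open>W\<close> of this truncation error is what allows averaging the trace over \<open>W\<close>.\<close>

lemma trace_truncation: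
  assumes \<rho>: "state \<rho>" and W: "unitary_op W" and t: "has_op_trace (\<rho> \<circ> W) t" and F: "finite F"
  shows "cmod ((\<Sum>A\<in>F. cinner (nvec A) (\<rho> (W (nvec A)))) - t) \<le> sqrt (1 - sum (occupation \<rho>) F)"
proof -
  have pos: "positive_op \<rho>" using \<rho> by (simp add: state_def)
  let ?c = "\<lambda>A. cinner (nvec A) (\<rho> (W (nvec A)))"
  \<comment> \<open>The diagonal of \<open>\<rho>\<close> in the rotated basis, again a probability
    distribution. Cauchy-Schwarz bounds each omitted term by
    sqrt(\<open>occupation \<rho> A\<close>) sqrt(\<open>p' A\<close>); after Cauchy-Schwarz for the
    sum, the \<open>p'\<close> factor is at most 1, so \<open>W\<close> drops out.\<close>
  define p' where "p' A = Re (cinner (W (nvec A)) (\<rho> (W (nvec A))))" for A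
  have p': "p' A \<ge> 0" "(p' has_sum 1) UNIV" for A
    using positive_opD(3)[OF pos] state_has_sum[OF \<rho> W] by (simp_all add: p'_def[abs_def])
  have bound: "cmod (sum ?c F - sum ?c F') \<le> sqrt (1 - sum (occupation \<rho>) F)"
    if F': "finite F'" "F \<subseteq> F'" for F'
  proof -
    have "cmod (sum ?c F - sum ?c F') = cmod (\<Sum>A\<in>F' - F. ?c A)"
      using F' by (simp add: sum_diff norm_minus_commute)
    also have "\<dots> \<le> (\<Sum>A\<in>F' - F. \<bar>sqrt (occupation \<rho> A)\<bar> * \<bar>sqrt (p' A)\<bar>)"
      using positive_op_Cauchy_Schwarz[OF pos] p'(1) occupation_nonneg[OF \<rho>]
      by (intro order_trans[OF norm_sum] sum_mono) (simp add: occupation_def p'_def)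
    also have "\<dots> \<le> L2_set (\<lambda>A. sqrt (occupation \<rho> A)) (F' - F) * L2_set (\<lambda>A. sqrt (p' A)) (F' - F)"
      by (rule L2_set_mult_ineq)
    also have "\<dots> = sqrt (sum (occupation \<rho>) (F' - F)) * sqrt (sum p' (F' - F))"
      by (simp add: L2_set_def p'(1) occupation_nonneg[OF \<rho>])
    also have "\<dots> \<le> sqrt (1 - sum (occupation \<rho>) F) * sqrt 1"
    proof (intro mult_mono real_sqrt_le_mono)
      show "sum (occupation \<rho>) (F' - F) \<le> 1 - sum (occupation \<rho>) F"
        using occupation_sum_le[OF \<rho> F'(1)] F' by (simp add: sum_diff)
      show "sum p' (F' - F) \<le> 1"
        using F'(1) by (intro finite_sum_le_has_sum[OF p'(2)] p'(1)) auto
    qed (auto intro!: sum_nonneg p'(1) occupation_sum_le \<rho> F)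
    finally show ?thesis by simp
  qed
  have "(?c has_sum t) UNIV" using has_op_trace_nvec[OF t unitary_op_id] by simp
  then have "((\<lambda>F'. cmod (sum ?c F - sum ?c F')) \<longlongrightarrow> cmod (sum ?c F - t)) (finite_subsets_at_top UNIV)"
    unfolding has_sum_def by (intro tendsto_intros)
  then show ?thesis
    by (rule tendsto_upperbound)
       (use F bound in \<open>auto simp: eventually_finite_subsets_at_top intro!: exI[of _ F]\<close>)
qed

lemma number_term_id:
  assumes \<rho>: "state \<rho>"
  shows "number_term \<rho> id k = of_real (real k * (\<Sum>A | size A = k. occupation \<rho> A))"
proof -
  have T: "cbounded_linear \<rho>" using \<rho> positive_opD(1) by (auto simp: state_def)
  have "has_op_trace (\<rho> \<circ> number_proj k) (\<Sum>A | size A = k. cinner (nvec A) (\<rho> (nvec A)))"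
    by (rule has_op_trace_finite_rank)
       (simp_all add: cbounded_linear_compose T cbounded_linear_number_proj number_proj_nvec
          cbounded_linear_sum[OF T] cbounded_linearD(2)[OF T])
  from op_trace_eq[OF this] have "op_trace (\<rho> \<circ> number_proj k) = (\<Sum>A | size A = k. cinner (nvec A) (\<rho> (nvec A)))" .
  then show ?thesis
    by (simp add: number_term_def cadjoint_unitary[OF unitary_op_id] occupation_complex[OF \<rho>])
qed

section \<open>Conjugation of states by unitaries\<close>

definition conjugate_op :: "('n fock \<Rightarrow> 'n fock) \<Rightarrow> ('n fock \<Rightarrow> 'n fock) \<Rightarrow> 'n fock \<Rightarrow> 'n fock" where
  "conjugate_op V \<rho> = V \<circ> \<rho> \<circ> inv V"

lemma has_op_trace_conjugate:
  assumes V: "unitary_op V" and T: "has_op_trace T t"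
  shows "has_op_trace (conjugate_op V T) t"
  unfolding has_op_trace_def
proof (intro conjI allI impI)
  show "cbounded_linear (conjugate_op V T)"
    using T V unitary_op_inv[OF V] unfolding conjugate_op_def has_op_trace_def
    by (intro cbounded_linear_compose) (auto intro: unitary_op_cbounded)
  fix B :: "'a fock set" assume B: "orthonormal_basis B"
  have "((\<lambda>b. cinner b (T b)) has_sum t) (inv V ` B)"
    by (rule has_op_traceD[OF T orthonormal_basis_image[OF unitary_op_inv[OF V] B]])
  then show "((\<lambda>b. cinner b (conjugate_op V T b)) has_sum t) B"
    by (simp add: has_sum_unitary_image[OF unitary_op_inv[OF V]] conjugate_op_def cinner_inv_left[OF V]
        unitary_op_inv_right[OF V])
qed

lemma state_conjugate:
  assumes V: "unitary_op V" and \<rho>: "state \<rho>"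
  shows "state (conjugate_op V \<rho>)"
proof -
  have "has_op_trace (conjugate_op V \<rho>) 1"
    using has_op_trace_conjugate[OF V] \<rho> by (simp add: state_def)
  moreover have "cinner f (conjugate_op V \<rho> f) = cinner (inv V f) (\<rho> (inv V f))" for f
    by (simp add: conjugate_op_def cinner_inv_left[OF V])
  ultimately show ?thesis
    using \<rho> by (simp add: state_def positive_op_def has_op_trace_def)
qed

text \<open>Moves the unitary from N to the state, so that only <N> has to be computed. The instance
  of cyclicity of the trace that is involved reduces to finite sums, because the number projections
  have finite rank.\<close>

lemma number_term_conjugate:
  fixes V :: "'n::finite fock \<Rightarrow> 'n fock"
  assumes V: "unitary_op V" and \<rho>: "state \<rho>"
  shows "number_term \<rho> V = number_term (conjugate_op V \<rho>) id"
proof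
  fix k
  have T: "cbounded_linear \<rho>" using \<rho> positive_opD(1) by (auto simp: state_def)
  note Vi = unitary_op_cbounded[OF unitary_op_inv[OF V]]
  have "has_op_trace (\<rho> \<circ> inv V \<circ> number_proj k \<circ> V) (\<Sum>A | size A = k. cinner (inv V (nvec A)) (\<rho> (inv V (nvec A))))"
    by (rule has_op_trace_finite_rank)
       (simp_all add: cbounded_linear_compose T Vi unitary_op_cbounded[OF V] cbounded_linear_number_proj
          number_proj_nvec cbounded_linear_sum[OF T] cbounded_linear_sum[OF Vi] cbounded_linearD(2)[OF T]
          cbounded_linearD(2)[OF Vi] cinner_inv_left[OF V])
  from op_trace_eq[OF this]
  have "number_term \<rho> V k = of_nat k * (\<Sum>A | size A = k. cinner (nvec A) (conjugate_op V \<rho> (nvec A)))"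
    by (simp add: number_term_def cadjoint_unitary[OF V] conjugate_op_def cinner_inv_left[OF V])
  then show "number_term \<rho> V k = number_term (conjugate_op V \<rho>) id k"
    by (simp add: number_term_id state_conjugate assms occupation_complex)
qed

section \<open>The mean number of particles of a Gaussian state\<close>

text \<open>
  An Abelian limit: the difference quotients \<open>(1 - s\<^sup>c) / (1 - s)\<close> increase to \<open>c\<close> as
  \<open>s = (1 - \<sigma>) / (1 + \<sigma>)\<close> increases to \<open>1\<close>.
\<close>

lemma has_sum_mean_of_generating_function:
  fixes p :: "'a \<Rightarrow> real" and c :: "'a \<Rightarrow> nat" and \<Phi> :: "real \<Rightarrow> real"
  defines "s \<equiv> \<lambda>\<sigma>. (1 - \<sigma>) / (1 + \<sigma>)"
  assumes p: "\<And>A. p A \<ge> 0" "(p has_sum 1) UNIV"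
    and gen: "\<And>\<sigma>. 0 < \<sigma> \<Longrightarrow> \<sigma> \<le> 1 \<Longrightarrow> ((\<lambda>A. s \<sigma> ^ c A * p A) has_sum (1 + \<sigma>) * \<Phi> \<sigma>) UNIV"
    and lim: "(\<lambda>n. (1 - \<Phi> (1 / Suc n)) / (1 / Suc n)) \<longlonglongrightarrow> \<kappa>"
  shows "((\<lambda>A. c A * p A) has_sum (\<kappa> - 1) / 2) UNIV"
proof -
  define \<sigma> where "\<sigma> n = 1 / real (Suc n)" for n
  define h where "h n a = (\<Sum>j<a. s (\<sigma> n) ^ j)" for n a
  \<comment> \<open>This is (1 - (1 + \<sigma>) \<Phi>(\<sigma>)) / (1 - s), rewritten with 1 - s =
    2 \<sigma> / (1 + \<sigma>) to exhibit the difference quotient of \<Phi> whose limit is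
    known.\<close>
  define T where "T n = ((1 - \<Phi> (\<sigma> n)) / \<sigma> n * (1 + \<sigma> n) - 1) * (1 + \<sigma> n) / 2" for n
  have \<sigma>: "0 < \<sigma> n" "\<sigma> n \<le> 1" for n by (auto simp: \<sigma>_def)
  have \<sigma>0: "\<sigma> \<longlonglongrightarrow> 0" unfolding \<sigma>_def by (rule LIMSEQ_Suc[OF lim_1_over_n])
  have s: "0 \<le> s (\<sigma> n)" "s (\<sigma> n) < 1" "1 - s (\<sigma> n) = 2 * \<sigma> n / (1 + \<sigma> n)" for n
    using \<sigma>[of n] by (auto simp: s_def field_simps)
  have "(\<lambda>n. s (\<sigma> n)) \<longlonglongrightarrow> (1 - 0) / (1 + 0)"
    unfolding s_def by (intro tendsto_intros \<sigma>0) simp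
  then have s1: "(\<lambda>n. s (\<sigma> n)) \<longlonglongrightarrow> 1" by simp
  have h_lim: "(\<lambda>n. h n a) \<longlonglongrightarrow> real a" for a
  proof -
    have "(\<lambda>n. h n a) \<longlonglongrightarrow> (\<Sum>j<a. 1 ^ j)" unfolding h_def by (intro tendsto_intros s1)
    then show ?thesis by simp
  qed
  have h_bounds: "0 \<le> h n a" "h n a \<le> real a" for n a
  proof -
    have "h n a \<le> (\<Sum>j<a. 1)" unfolding h_def by (intro sum_mono power_le_one) (use s[of n] in auto)
    then show "h n a \<le> real a" by simp
    show "0 \<le> h n a" unfolding h_def by (intro sum_nonneg) (use s[of n] in auto)
  qed
  have T: "((\<lambda>A. h n (c A) * p A) has_sum T n) UNIV" for n
  proof -
    have "((\<lambda>A. (p A - s (\<sigma> n) ^ c A * p A) / (1 - s (\<sigma> n))) has_sum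
        (1 - (1 + \<sigma> n) * \<Phi> (\<sigma> n)) / (1 - s (\<sigma> n))) UNIV"
      using has_sum_add[OF p(2) has_sum_uminusI[OF gen[OF \<sigma>]]] by (intro has_sum_divide_const) simp
    moreover have "(p A - s (\<sigma> n) ^ c A * p A) / (1 - s (\<sigma> n)) = h n (c A) * p A" for A
    proof -
      have "p A - s (\<sigma> n) ^ c A * p A = (1 - s (\<sigma> n) ^ c A) * p A" by (simp add: left_diff_distrib)
      also have "\<dots> = (1 - s (\<sigma> n)) * (h n (c A) * p A)"
        unfolding h_def one_diff_power_eq by (simp only: mult.assoc)
      finally show ?thesis using s(2)[of n] by simp
    qed
    moreover have "(1 - (1 + \<sigma> n) * \<Phi> (\<sigma> n)) / (1 - s (\<sigma> n)) = T n"
      unfolding s(3) T_def using \<sigma>[of n] by (simp add: field_simps)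
    ultimately show ?thesis by simp
  qed
  have "T \<longlonglongrightarrow> (\<kappa> * (1 + 0) - 1) * (1 + 0) / 2"
    unfolding T_def by (intro tendsto_intros \<sigma>0) (use lim in \<open>simp add: \<sigma>_def\<close>, simp)
  then have T_lim: "T \<longlonglongrightarrow> (\<kappa> - 1) / 2" by simp
  \<comment> \<open>Finite sums come first, as in Fatou's lemma: they prove that the mean is finite.
    Only then does \<open>h n a \<le> real a\<close> give the reverse inequality.\<close>
  have upper: "(\<Sum>A\<in>F. c A * p A) \<le> (\<kappa> - 1) / 2" if "finite F" for F
  proof (rule LIMSEQ_le[OF _ T_lim])
    show "(\<lambda>n. \<Sum>A\<in>F. h n (c A) * p A) \<longlonglongrightarrow> (\<Sum>A\<in>F. c A * p A)"
      by (intro tendsto_intros h_lim)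
    have "(\<Sum>A\<in>F. h n (c A) * p A) \<le> T n" for n
      using that h_bounds p(1) by (intro finite_sum_le_has_sum[OF T]) auto
    then show "\<exists>N. \<forall>n\<ge>N. (\<Sum>A\<in>F. h n (c A) * p A) \<le> T n" by blast
  qed
  have summable: "(\<lambda>A. c A * p A) summable_on UNIV"
    by (rule nonneg_bdd_above_summable_on, simp add: p, rule bdd_aboveI[of _ "(\<kappa> - 1) / 2"])
       (use upper in auto)
  have "infsum (\<lambda>A. c A * p A) UNIV \<le> (\<kappa> - 1) / 2"
    by (rule infsum_le_finite_sums[OF summable]) (rule upper)
  moreover have "(\<kappa> - 1) / 2 \<le> infsum (\<lambda>A. c A * p A) UNIV"
  proof (rule LIMSEQ_le_const2[OF T_lim])
    have "T n \<le> infsum (\<lambda>A. c A * p A) UNIV" for n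
      by (rule has_sum_mono[OF T has_sum_infsum[OF summable]]) (intro mult_right_mono h_bounds p(1))
    then show "\<exists>N. \<forall>n\<ge>N. T n \<le> infsum (\<lambda>A. c A * p A) UNIV" by blast
  qed
  ultimately show ?thesis using has_sum_infsum[OF summable] by simp
qed

section \<open>Second order behaviour of the characteristic function at zero\<close>

lemma one_minus_cos_le: "1 - cos b \<le> b\<^sup>2 / 2" for b :: real
proof -
  have "1 - cos b = 2 * (sin (b / 2))\<^sup>2" using cos_double_sin[of "b / 2"] by simp
  also have "\<dots> \<le> 2 * (b / 2)\<^sup>2"
    using abs_sin_x_le_abs_x[of "b / 2"] by (intro mult_left_mono) (simp_all add: abs_le_square_iff[symmetric])
  finally show ?thesis by (simp add: power_divide)
qed

text \<open>Split off 1 - exp(-a), leaving exp(-a) (1 - cos b). This supplies the majorant for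
  dominated convergence.\<close>

lemma abs_one_minus_exp_cos_le:
  fixes a b :: real
  assumes "a \<ge> 0"
  shows "\<bar>1 - exp (- a) * cos b\<bar> \<le> a + b\<^sup>2 / 2"
proof -
  have "1 - exp (- a) * cos b = (1 - exp (- a)) + exp (- a) * (1 - cos b)" by (simp add: algebra_simps)
  moreover have "1 - exp (- a) \<le> a" using exp_ge_add_one_self[of "- a"] by simp
  moreover have "exp (- a) * (1 - cos b) \<le> 1 * (b\<^sup>2 / 2)"
    using assms one_minus_cos_le by (intro mult_mono) auto
  moreover have "exp (- a) \<le> 1" "0 \<le> exp (- a) * (1 - cos b)" using assms by simp_all
  ultimately show ?thesis by linarith
qed

text \<open>The exponential contributes its derivative at 0. The cosine has argument of order sqrt
  \<sigma>, so its quadratic term is of order \<sigma> and the Taylor remainder of order \<sigma>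
  sqrt \<sigma>; the factor sqrt 2 cancels the 1/2 of the quadratic term.\<close>

lemma exp_cos_quotient_limit:
  fixes Q L :: real
  assumes "Q \<ge> 0"
  shows "(\<lambda>n. (1 - exp (- (1 / Suc n * Q)) * cos (sqrt 2 * (sqrt (1 / Suc n) * L))) / (1 / Suc n))
    \<longlonglongrightarrow> Q + L\<^sup>2"
proof -
  define \<sigma> where "\<sigma> n = 1 / real (Suc n)" for n
  define b where "b n = sqrt 2 * (sqrt (\<sigma> n) * L)" for n
  have \<sigma>: "\<sigma> n > 0" for n by (simp add: \<sigma>_def)
  have \<sigma>0: "\<sigma> \<longlonglongrightarrow> 0" unfolding \<sigma>_def by (rule LIMSEQ_Suc[OF lim_1_over_n])
  have "((\<lambda>h. exp (- (h * Q))) has_field_derivative - Q) (at 0)"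
    by (auto intro!: derivative_eq_intros)
  then have "((\<lambda>h. (exp (- (h * Q)) - 1) / h) \<longlongrightarrow> - Q) (at 0)"
    by (simp add: has_field_derivative_iff)
  then have "(\<lambda>n. (exp (- (\<sigma> n * Q)) - 1) / \<sigma> n) \<longlonglongrightarrow> - Q"
    by (rule filterlim_compose) (use \<sigma>0 \<sigma> in \<open>auto simp: filterlim_at less_imp_neq[symmetric]\<close>)
  then have 1: "(\<lambda>n. (1 - exp (- (\<sigma> n * Q))) / \<sigma> n) \<longlonglongrightarrow> Q"
    using tendsto_minus by (fastforce simp: minus_divide_left)
  have bound: "\<bar>(1 - cos (b n)) / \<sigma> n - L\<^sup>2\<bar> \<le> \<bar>sqrt 2 * L\<bar> ^ 3 / 6 * sqrt (\<sigma> n)" for n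
  proof -
    have "cmod (iexp (b n) - (\<Sum>k\<le>2. (\<i> * b n) ^ k / fact k)) \<le> \<bar>b n\<bar> ^ 3 / 6"
      using iexp_approx1[of "b n" 2] by (simp add: eval_nat_numeral)
    then have "\<bar>cos (b n) - (1 - (b n)\<^sup>2 / 2)\<bar> \<le> \<bar>b n\<bar> ^ 3 / 6"
    proof -
      have "Re (iexp (b n) - (\<Sum>k\<le>2. (\<i> * b n) ^ k / fact k)) = cos (b n) - (1 - (b n)\<^sup>2 / 2)"
        by (simp add: Re_exp eval_nat_numeral)
      then show ?thesis
        using abs_Re_le_cmod[of "iexp (b n) - (\<Sum>k\<le>2. (\<i> * b n) ^ k / fact k)"]
          \<open>cmod (iexp (b n) - (\<Sum>k\<le>2. (\<i> * b n) ^ k / fact k)) \<le> \<bar>b n\<bar> ^ 3 / 6\<close> by linarith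
    qed
    moreover have "(b n)\<^sup>2 / 2 = \<sigma> n * L\<^sup>2"
      using \<sigma>[of n] by (simp add: b_def power_mult_distrib)
    moreover have "\<bar>b n\<bar> ^ 3 = \<sigma> n * (\<bar>sqrt 2 * L\<bar> ^ 3 * sqrt (\<sigma> n))"
      using \<sigma>[of n] by (simp add: b_def abs_mult power_mult_distrib power3_eq_cube)
    ultimately have "\<bar>(1 - cos (b n)) - \<sigma> n * L\<^sup>2\<bar> \<le> \<sigma> n * (\<bar>sqrt 2 * L\<bar> ^ 3 / 6 * sqrt (\<sigma> n))"
      by linarith
    moreover have "\<bar>(1 - cos (b n)) - \<sigma> n * L\<^sup>2\<bar> = \<sigma> n * \<bar>(1 - cos (b n)) / \<sigma> n - L\<^sup>2\<bar>"
    proof -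
      have "(1 - cos (b n)) - \<sigma> n * L\<^sup>2 = \<sigma> n * ((1 - cos (b n)) / \<sigma> n - L\<^sup>2)"
        using \<sigma>[of n] by (simp add: field_simps)
      then show ?thesis using \<sigma>[of n] by (simp only: abs_mult abs_of_pos)
    qed
    ultimately show ?thesis using \<sigma>[of n] by simp
  qed
  have "(\<lambda>n. \<bar>sqrt 2 * L\<bar> ^ 3 / 6 * sqrt (\<sigma> n)) \<longlonglongrightarrow> \<bar>sqrt 2 * L\<bar> ^ 3 / 6 * sqrt 0"
    by (intro tendsto_intros \<sigma>0)
  then have "(\<lambda>n. \<bar>sqrt 2 * L\<bar> ^ 3 / 6 * sqrt (\<sigma> n)) \<longlonglongrightarrow> 0" by simp
  then have "(\<lambda>n. (1 - cos (b n)) / \<sigma> n - L\<^sup>2) \<longlonglongrightarrow> 0"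
    by (rule Lim_null_comparison[rotated]) (use bound in \<open>auto intro!: always_eventually\<close>)
  then have 2: "(\<lambda>n. (1 - cos (b n)) / \<sigma> n) \<longlonglongrightarrow> L\<^sup>2" by (rule LIM_zero_cancel)
  have "(\<lambda>n. exp (- (\<sigma> n * Q))) \<longlonglongrightarrow> exp (- (0 * Q))" by (intro tendsto_intros \<sigma>0)
  then have "(\<lambda>n. (1 - exp (- (\<sigma> n * Q))) / \<sigma> n + exp (- (\<sigma> n * Q)) * ((1 - cos (b n)) / \<sigma> n))
      \<longlonglongrightarrow> Q + exp (- (0 * Q)) * L\<^sup>2"
    by (intro tendsto_add tendsto_mult 1 2)
  moreover have "(1 - exp (- (\<sigma> n * Q))) / \<sigma> n + exp (- (\<sigma> n * Q)) * ((1 - cos (b n)) / \<sigma> n)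
      = (1 - exp (- (\<sigma> n * Q)) * cos (b n)) / \<sigma> n" for n
    by (simp add: diff_divide_distrib algebra_simps)
  ultimately show ?thesis by (simp add: \<sigma>_def b_def)
qed

lemma std_normal_moments:
  "has_bochner_integral std_normal_distribution (\<lambda>x. 1 :: real) 1"
  "has_bochner_integral std_normal_distribution (\<lambda>x. x) (0 :: real)"
  "has_bochner_integral std_normal_distribution (\<lambda>x. x\<^sup>2) (1 :: real)"
  using std_normal_distribution_even_moments[of 0] std_normal_distribution_even_moments[of 1]
    integral_std_normal_distribution_moment_odd[of 1] integrable_std_normal_distribution_moment[of 1]
  by (auto simp: has_bochner_integral_iff)

lemma has_bochner_integral_quadratic_form:
  "has_bochner_integral gauss2 (\<lambda>z. a * (fst z)\<^sup>2 + b * (fst z * snd z) + c * (snd z)\<^sup>2) (a + c)" for a b c :: real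
proof -
  note m = std_normal_moments
  have "has_bochner_integral gauss2 (\<lambda>z. a * (\<lambda>(x, y). x\<^sup>2 * 1) z + b * (\<lambda>(x, y). x * y) z + c * (\<lambda>(x, y). 1 * y\<^sup>2) z)
      (a * (1 * 1) + b * (0 * 0) + c * (1 * 1))"
    by (intro has_bochner_integral_add has_bochner_integral_mult_right has_bochner_integral_gauss2 m)
  then show ?thesis by (simp add: case_prod_beta)
qed

lemma stack_axis: "stack (axis i a) (axis i b) = axis (Inl i) a + axis (Inr i) b"
  by (simp add: vec_eq_iff stack_def axis_def split: sum.split)

lemma cvec_axis: "cvec (axis i a) (axis i b) = axis i (Complex a b)"
  by (simp add: vec_eq_iff cvec_def axis_def zero_complex.code)

lemma sum_UNIV_sum:
  fixes f :: "'a::finite + 'b::finite \<Rightarrow> 'c::comm_monoid_add"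
  shows "sum f UNIV = (\<Sum>i\<in>UNIV. f (Inl i)) + (\<Sum>i\<in>UNIV. f (Inr i))"
proof -
  have "sum f UNIV = sum f (UNIV <+> UNIV)" by simp
  also have "\<dots> = (\<Sum>i\<in>UNIV. f (Inl i)) + (\<Sum>i\<in>UNIV. f (Inr i))"
    by (subst sum.Plus) auto
  finally show ?thesis .
qed

text \<open>The mean is a single vector \<open>w\<close>, which is \<open>stack l (- m)\<close> for
  a Gaussian state. The shape is preserved by the conjugations with Weyl operators and with
  \<Gamma>(L), so one formula for <N> serves the original and both transformed states.\<close>

locale gaussian_characteristic =
  fixes \<rho> :: "'n::finite fock \<Rightarrow> 'n fock" and w :: "real ^ ('n + 'n)" and S :: "real ^ ('n + 'n) ^ ('n + 'n)"
  assumes state: "state \<rho>"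
    and char: "\<And>x y. has_op_trace (\<rho> \<circ> weyl (cvec x y))
      (exp (- \<i> * complex_of_real (sqrt 2 * (w \<bullet> stack x y)) - complex_of_real (stack x y \<bullet> (S *v stack x y))))"
begin

definition mode_mean :: "'n \<Rightarrow> real \<times> real \<Rightarrow> real" where
  "mode_mean i z = fst z * w $ Inl i + snd z * w $ Inr i"

definition mode_var :: "'n \<Rightarrow> real \<times> real \<Rightarrow> real" where
  "mode_var i z = S $ Inl i $ Inl i * (fst z)\<^sup>2 + (S $ Inl i $ Inr i + S $ Inr i $ Inl i) * (fst z * snd z)
    + S $ Inr i $ Inr i * (snd z)\<^sup>2"

definition mode_char :: "'n \<Rightarrow> real \<Rightarrow> real \<times> real \<Rightarrow> complex" where
  "mode_char i \<sigma> z = exp (Complex (- (\<sigma> * mode_var i z)) (- (sqrt 2 * (sqrt \<sigma> * mode_mean i z))))"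

lemma mode_char:
  assumes "\<sigma> > 0"
  shows "has_op_trace (\<rho> \<circ> weyl (mode_vec i \<sigma> z)) (mode_char i \<sigma> z)"
proof -
  obtain x y where z: "z = (x, y)" by force
  let ?v = "stack (axis i (sqrt \<sigma> * x)) (axis i (sqrt \<sigma> * y))"
  have S: "(S *v axis k a) $ j = S $ j $ k * a" for j k a
    by (simp add: matrix_vector_mul_component inner_axis)
  have sqrt: "sqrt \<sigma> * (sqrt \<sigma> * a) = \<sigma> * a" for a
    using assms by (simp flip: mult.assoc)
  have "?v \<bullet> (S *v ?v) = \<sigma> * mode_var i z"
    by (simp add: sqrt stack_axis matrix_vector_right_distrib inner_add_left inner_axis' S mode_var_def z
        power2_eq_square algebra_simps)
  moreover have "w \<bullet> ?v = sqrt \<sigma> * mode_mean i z"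
    by (simp add: stack_axis inner_add_right inner_axis mode_mean_def z algebra_simps)
  moreover have "- \<i> * of_real a - of_real b = Complex (- b) (- a)" for a b
    by (simp add: complex_eq_iff)
  ultimately show ?thesis
    using char[of "axis i (sqrt \<sigma> * x)" "axis i (sqrt \<sigma> * y)"]
    by (simp only: cvec_axis mode_vec_def z mode_char_def prod.case)
qed

text \<open>A state has trace of modulus at most 1 against a Weyl operator: this is
  \<open>trace_truncation\<close> for the empty set. The modulus of \<open>mode_char i 1 z\<close>
  is exp(-\<open>mode_var i z\<close>).\<close>

lemma mode_var_nonneg: "mode_var i z \<ge> 0"
proof -
  have "cmod (mode_char i 1 z) \<le> 1"
    using trace_truncation[OF state weyl_unitary mode_char[of 1 i z], of "{}"] by simp
  then show ?thesis by (simp add: mode_char_def)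
qed

lemma Re_mode_char: "Re (mode_char i \<sigma> z) = exp (- (\<sigma> * mode_var i z)) * cos (sqrt 2 * (sqrt \<sigma> * mode_mean i z))"
  by (simp add: mode_char_def Re_exp)

lemma mode_measurable [measurable]:
  "mode_mean i \<in> borel_measurable gauss2" "mode_var i \<in> borel_measurable gauss2"
  "mode_char i \<sigma> \<in> borel_measurable gauss2"
proof -
  show 1: "mode_mean i \<in> borel_measurable gauss2" "mode_var i \<in> borel_measurable gauss2"
    unfolding mode_mean_def mode_var_def by measurable
  have "mode_char i \<sigma> = (\<lambda>z. of_real (exp (- (\<sigma> * mode_var i z))) * cis (- (sqrt 2 * (sqrt \<sigma> * mode_mean i z))))"
    by (auto simp: mode_char_def exp_eq_polar)
  moreover have "(\<lambda>z. of_real (exp (- (\<sigma> * mode_var i z))) * cis (- (sqrt 2 * (sqrt \<sigma> * mode_mean i z)))) \<in> borel_measurable gauss2"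
    unfolding cis_conv_exp using 1 by measurable
  ultimately show "mode_char i \<sigma> \<in> borel_measurable gauss2" by simp
qed

lemma integrable_mode_char: "\<sigma> \<ge> 0 \<Longrightarrow> integrable gauss2 (mode_char i \<sigma>)"
  by (rule gauss2.integrable_const_bound[of _ 1]) (auto simp: mode_char_def mode_var_nonneg)

text \<open>On finite sets of patterns the average is computed by \<open>integral_weyl\<close>. The
  truncation error is bounded independently of \<open>z\<close>, so it survives integration and
  vanishes along growing finite sets.\<close>

lemma occupation_generating_function:
  assumes "\<sigma> > 0"
  shows "((\<lambda>A. ((1 - \<sigma>) / (1 + \<sigma>)) ^ count A i * occupation \<rho> A)
    has_sum (1 + \<sigma>) * (LINT z|gauss2. Re (mode_char i \<sigma> z))) UNIV"
proof -
  define s where "s = (1 - \<sigma>) / (1 + \<sigma>)"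
  have "\<bar>s\<bar> \<le> 1" using assms by (auto simp: s_def abs_le_iff field_simps)
  have pos: "positive_op \<rho>" using state by (simp add: state_def)
  let ?W = "\<lambda>z. weyl (mode_vec i \<sigma> z)"
  let ?c = "\<lambda>z A. cinner (nvec A) (\<rho> (?W z (nvec A)))"
  let ?X = "\<lambda>F. \<Sum>A\<in>F. of_real (s ^ count A i * occupation \<rho> A) / of_real (1 + \<sigma>) :: complex"
  let ?\<Phi> = "LINT z|gauss2. mode_char i \<sigma> z"
  note int = integrable_mode_char[OF less_imp_le[OF assms]]
  have c_int: "has_bochner_integral gauss2 (\<lambda>z. ?c z A) (of_real (s ^ count A i * occupation \<rho> A) / of_real (1 + \<sigma>))" for A
  proof -
    have "cinner (\<rho> (nvec A)) (nvec A) = of_real (occupation \<rho> A)"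
      by (simp add: occupation_complex[OF state] flip: positive_op_hermitian[OF pos])
    then have "(LINT z|gauss2. cinner (\<rho> (nvec A)) (?W z (nvec A)))
        = of_real (s ^ count A i * occupation \<rho> A) / of_real (1 + \<sigma>)"
      unfolding integral_weyl[OF assms] s_def[symmetric] mode_scale_nvec[OF \<open>\<bar>s\<bar> \<le> 1\<close>] by simp
    then show ?thesis
      \<comment> \<open>\<open>\<rho>\<close> is moved to the left argument, so that
        \<open>integral_weyl\<close> sees a bare matrix element of the Weyl operator.\<close>
      unfolding positive_op_hermitian[OF pos] has_bochner_integral_iff using integrable_weyl by blast
  qed
  have bound: "cmod (?X F - ?\<Phi>) \<le> sqrt (1 - sum (occupation \<rho>) F)" if F: "finite F" for F
  proof -
    have "has_bochner_integral gauss2 (\<lambda>z. (\<Sum>A\<in>F. ?c z A) - mode_char i \<sigma> z) (?X F - ?\<Phi>)"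
      by (intro has_bochner_integral_diff has_bochner_integral_sum c_int has_bochner_integral_integrable int)
    then have i: "integrable gauss2 (\<lambda>z. (\<Sum>A\<in>F. ?c z A) - mode_char i \<sigma> z)"
      and eq: "?X F - ?\<Phi> = (LINT z|gauss2. (\<Sum>A\<in>F. ?c z A) - mode_char i \<sigma> z)"
      by (simp_all only: has_bochner_integral_iff)
    have "cmod (?X F - ?\<Phi>) \<le> (LINT z|gauss2. sqrt (1 - sum (occupation \<rho>) F))"
      unfolding eq
      by (rule Bochner_Integration.integral_norm_bound_integral[OF i])
         (auto intro!: trace_truncation state weyl_unitary mode_char assms F)
    then show ?thesis by (simp add: gauss2.prob_space)
  qed
  have "((\<lambda>F. sqrt (1 - sum (occupation \<rho>) F)) \<longlongrightarrow> sqrt (1 - 1)) (finite_subsets_at_top UNIV)"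
    using occupation_has_sum[OF state] unfolding has_sum_def by (intro tendsto_intros)
  then have "((\<lambda>F. ?X F - ?\<Phi>) \<longlongrightarrow> 0) (finite_subsets_at_top UNIV)"
    by (intro Lim_null_comparison[OF eventually_finite_subsets_at_top_weakI[OF bound]]) simp_all
  then have "((\<lambda>A. of_real (s ^ count A i * occupation \<rho> A) / of_real (1 + \<sigma>)) has_sum ?\<Phi>) UNIV"
    unfolding has_sum_def by (rule LIM_zero_cancel)
  then have "((\<lambda>A. Re (of_real (s ^ count A i * occupation \<rho> A) / of_real (1 + \<sigma>))) has_sum Re ?\<Phi>) UNIV"
    by (rule has_sum_Re)
  moreover have "Re (of_real a / of_real b) = a / b" for a b
    by (simp flip: of_real_divide)
  ultimately have "((\<lambda>A. s ^ count A i * occupation \<rho> A / (1 + \<sigma>)) has_sum Re ?\<Phi>) UNIV"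
    by simp
  from has_sum_cmult_right[OF this, of "1 + \<sigma>"] show ?thesis
    using assms int by (simp add: s_def)
qed

text \<open>The first order coefficient in \<sigma> is the normal average of the quadratic form of
  \<open>S\<close> plus the squared linear form of \<open>w\<close>, both restricted to the mode.
  The mixed term averages to zero, each square to one.\<close>

lemma mode_occupation_has_sum:
  "((\<lambda>A. count A i * occupation \<rho> A) has_sum
    (S $ Inl i $ Inl i + S $ Inr i $ Inr i + (w $ Inl i)\<^sup>2 + (w $ Inr i)\<^sup>2 - 1) / 2) UNIV"
proof (rule has_sum_mean_of_generating_function[where \<Phi> = "\<lambda>\<sigma>. LINT z|gauss2. Re (mode_char i \<sigma> z)"])
  let ?g = "\<lambda>z. mode_var i z + (mode_mean i z)\<^sup>2"
  let ?\<kappa> = "S $ Inl i $ Inl i + S $ Inr i $ Inr i + (w $ Inl i)\<^sup>2 + (w $ Inr i)\<^sup>2"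
  have g_eq: "?g = (\<lambda>z. (S $ Inl i $ Inl i + (w $ Inl i)\<^sup>2) * (fst z)\<^sup>2
      + (S $ Inl i $ Inr i + S $ Inr i $ Inl i + 2 * w $ Inl i * w $ Inr i) * (fst z * snd z)
      + (S $ Inr i $ Inr i + (w $ Inr i)\<^sup>2) * (snd z)\<^sup>2)"
    by (rule ext) (simp add: mode_var_def mode_mean_def power2_eq_square algebra_simps)
  have "has_bochner_integral gauss2 ?g
      (S $ Inl i $ Inl i + (w $ Inl i)\<^sup>2 + (S $ Inr i $ Inr i + (w $ Inr i)\<^sup>2))"
    unfolding g_eq by (rule has_bochner_integral_quadratic_form)
  then have g: "has_bochner_integral gauss2 ?g ?\<kappa>"
    by (simp only: ac_simps)
  define \<sigma> where "\<sigma> n = 1 / real (Suc n)" for n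
  have \<sigma>: "\<sigma> n > 0" for n by (simp add: \<sigma>_def)
  have "(\<lambda>n. LINT z|gauss2. (1 - Re (mode_char i (\<sigma> n) z)) / \<sigma> n) \<longlonglongrightarrow> (LINT z|gauss2. ?g z)"
  \<comment> \<open>The limit function dominates its own difference quotients.\<close>
  proof (rule integral_dominated_convergence[where w = ?g])
    show "AE z in gauss2. (\<lambda>n. (1 - Re (mode_char i (\<sigma> n) z)) / \<sigma> n) \<longlonglongrightarrow> ?g z"
      unfolding Re_mode_char \<sigma>_def using exp_cos_quotient_limit[OF mode_var_nonneg] by simp
    show "AE z in gauss2. norm ((1 - Re (mode_char i (\<sigma> n) z)) / \<sigma> n) \<le> ?g z" for n
    proof (rule AE_I2)
      fix z
      have "\<bar>1 - Re (mode_char i (\<sigma> n) z)\<bar> \<le> \<sigma> n * ?g z"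
        using abs_one_minus_exp_cos_le[of "\<sigma> n * mode_var i z" "sqrt 2 * (sqrt (\<sigma> n) * mode_mean i z)"]
          \<sigma>[of n] mode_var_nonneg[of i z]
        by (simp add: Re_mode_char power_mult_distrib distrib_left)
      then show "norm ((1 - Re (mode_char i (\<sigma> n) z)) / \<sigma> n) \<le> ?g z"
        using \<sigma>[of n] by (simp add: divide_le_eq mult.commute)
    qed
    show "integrable gauss2 ?g" using g by (simp add: has_bochner_integral_iff)
  qed measurable
  moreover have "(LINT z|gauss2. (1 - Re (mode_char i (\<sigma> n) z)) / \<sigma> n)
      = (1 - (LINT z|gauss2. Re (mode_char i (\<sigma> n) z))) / \<sigma> n" for n
    using integrable_mode_char[of "\<sigma> n" i] \<sigma>[of n] by (simp add: gauss2.prob_space)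
  ultimately show "(\<lambda>n. (1 - (LINT z|gauss2. Re (mode_char i (1 / Suc n) z))) / (1 / Suc n)) \<longlonglongrightarrow> ?\<kappa>"
    using g by (simp add: has_bochner_integral_iff \<sigma>_def)
qed (simp_all add: occupation_nonneg occupation_has_sum state occupation_generating_function)

lemma size_occupation_has_sum:
  "((\<lambda>A. size A * occupation \<rho> A) has_sum (trace S - CARD('n) + w \<bullet> w) / 2) UNIV"
proof -
  let ?k = "\<lambda>i. (S $ Inl i $ Inl i + S $ Inr i $ Inr i + (w $ Inl i)\<^sup>2 + (w $ Inr i)\<^sup>2 - 1) / 2"
  have "((\<lambda>A. \<Sum>i\<in>I. count A i * occupation \<rho> A) has_sum (\<Sum>i\<in>I. ?k i)) UNIV" for I
    by (induction I rule: infinite_finite_induct) (auto intro!: has_sum_add mode_occupation_has_sum)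
  then have "((\<lambda>A. \<Sum>i\<in>UNIV. count A i * occupation \<rho> A) has_sum (\<Sum>i\<in>UNIV. ?k i)) UNIV" .
  moreover have "(\<Sum>i\<in>UNIV. count A i * occupation \<rho> A) = size A * occupation \<rho> A" for A
  proof -
    have "size A = (\<Sum>i\<in>UNIV. count A i)"
      unfolding size_multiset_overloaded_eq
      by (rule sum.mono_neutral_left) (auto simp: count_eq_zero_iff)
    then show ?thesis by (simp add: sum_distrib_right)
  qed
  moreover have "(\<Sum>i\<in>UNIV. ?k i) = (trace S - CARD('n) + w \<bullet> w) / 2"
    by (simp add: trace_def inner_vec_def sum_UNIV_sum sum.distrib sum_subtractf power2_eq_square
        flip: sum_divide_distrib)
  ultimately show ?thesis by simp
qed

text \<open>Grouping the unordered sum over patterns by particle number turns it into the series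
  that defines <N>.\<close>

lemma number_term_sums:
  "number_term \<rho> id sums complex_of_real ((trace S - CARD('n) + w \<bullet> w) / 2)"
proof -
  let ?f = "\<lambda>A. size A * occupation \<rho> A"
  have "(?f has_sum (trace S - CARD('n) + w \<bullet> w) / 2) (snd ` Sigma UNIV (\<lambda>k. {A. size A = k}))"
    using size_occupation_has_sum by (simp add: image_def)
  moreover have "inj_on snd (Sigma UNIV (\<lambda>k. {A :: 'n multiset. size A = k}))"
    by (auto simp: inj_on_def)
  ultimately have "((\<lambda>z. ?f (snd z)) has_sum (trace S - CARD('n) + w \<bullet> w) / 2)
      (Sigma UNIV (\<lambda>k. {A. size A = k}))"
    by (simp add: has_sum_reindex o_def)
  then have "((\<lambda>k. \<Sum>A | size A = k. ?f A) has_sum (trace S - CARD('n) + w \<bullet> w) / 2) UNIV"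
    by (rule has_sum_SigmaD) (simp add: has_sum_finiteI finite_size_eq)
  then have "((\<lambda>k. complex_of_real (\<Sum>A | size A = k. ?f A)) has_sum
      of_real ((trace S - CARD('n) + w \<bullet> w) / 2)) UNIV"
    by (rule has_sum_of_real)
  moreover have "number_term \<rho> id = (\<lambda>k. complex_of_real (\<Sum>A | size A = k. ?f A))"
  proof
    fix k
    have "(\<Sum>A | size A = k. ?f A) = k * (\<Sum>A | size A = k. occupation \<rho> A)"
      by (simp add: sum_distrib_left)
    then show "number_term \<rho> id k = complex_of_real (\<Sum>A | size A = k. ?f A)"
      by (simp only: number_term_id[OF state])
  qed
  ultimately show ?thesis by (simp only: has_sum_imp_sums)
qed

end

section \<open>Displacements and symplectic transformations\<close>

lemma inner_stack: "stack a b \<bullet> stack c d = a \<bullet> c + b \<bullet> d"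
  by (simp add: inner_vec_def stack_def sum_UNIV_sum)

lemma stack_upper_lower: "stack (upper v) (lower v) = v"
  by (simp add: vec_eq_iff stack_def upper_def lower_def split: sum.split)

text \<open>Tr(V \<rho> V^-1 W(z)) = Tr(\<rho> V^-1 W(z) V). A displacement keeps z and produces the
  phase \<open>c\<close>; for \<Gamma>(L) the phase is 1 and z moves.\<close>

lemma weyl_conjugation:
  assumes V: "unitary_op V" and T: "inv V \<circ> weyl z \<circ> V = (\<lambda>f. c *\<^sub>C weyl z' f)"
    and t: "has_op_trace (\<rho> \<circ> weyl z') t" and \<rho>: "cbounded_linear \<rho>"
  shows "has_op_trace (conjugate_op V \<rho> \<circ> weyl z) (c * t)"
proof -
  have "has_op_trace (\<lambda>f. c *\<^sub>C (\<rho> \<circ> weyl z') f) (c * t)"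
    using t unfolding has_op_trace_def by (auto simp: o_def intro!: cbounded_linear_scale has_sum_cmult_right)
  from has_op_trace_conjugate[OF V this]
  have "has_op_trace (V \<circ> (\<lambda>f. c *\<^sub>C (\<rho> \<circ> weyl z') f) \<circ> inv V) (c * t)" by (simp add: conjugate_op_def)
  moreover have "V (c *\<^sub>C \<rho> (weyl z' (inv V f))) = conjugate_op V \<rho> (weyl z f)" for f
    using fun_cong[OF T, of "inv V f"]
    by (simp add: conjugate_op_def unitary_op_inv_right[OF V] cbounded_linearD(2)[OF \<rho>])
  ultimately show ?thesis by (simp add: o_def)
qed

lemma cdot_cvec_diff:
  "cdot (cvec x y) (cvec x' y') - cdot (cvec x' y') (cvec x y) = 2 * \<i> * of_real (x \<bullet> y' - y \<bullet> x')"
  by (simp add: cdot_def cvec_def inner_vec_def complex_eq_iff sum_subtractf[symmetric] algebra_simps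
      sum_distrib_left)

text \<open>The commutation phase has exponent 2 i (x.y' - y.x'), linear in the argument (x', y'),
  so it is absorbed into the mean. Writing 2 as sqrt 2 times sqrt 2 gives the shift (sqrt 2 y, -
  sqrt 2 x); \<open>S\<close> is unchanged.\<close>

lemma gaussian_characteristic_weyl:
  assumes "gaussian_characteristic \<rho> (stack l m') S"
  shows "gaussian_characteristic (conjugate_op (weyl (cvec x y)) \<rho>)
    (stack (l + sqrt 2 *\<^sub>R y) (m' - sqrt 2 *\<^sub>R x)) S"
proof -
  interpret gaussian_characteristic \<rho> "stack l m'" S by fact
  let ?U = "weyl (cvec x y)"
  show ?thesis
  proof
    show "state (conjugate_op ?U \<rho>)" by (rule state_conjugate[OF weyl_unitary state])
    fix x' y'
    let ?c = "exp (cdot (cvec x y) (cvec x' y') - cdot (cvec x' y') (cvec x y))"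
    have T: "inv ?U \<circ> weyl (cvec x' y') \<circ> ?U = (\<lambda>f. ?c *\<^sub>C weyl (cvec x' y') f)"
    proof
      fix f
      show "(inv ?U \<circ> weyl (cvec x' y') \<circ> ?U) f = ?c *\<^sub>C weyl (cvec x' y') f"
        using fun_cong[OF weyl_commutation[of "cvec x' y'" "cvec x y"], of f]
        by (simp add: cbounded_linearD(2)[OF unitary_op_cbounded[OF unitary_op_inv[OF weyl_unitary]]]
            unitary_op_inv_left[OF weyl_unitary])
    qed
    have "has_op_trace (conjugate_op ?U \<rho> \<circ> weyl (cvec x' y'))
      (?c * exp (- \<i> * complex_of_real (sqrt 2 * (stack l m' \<bullet> stack x' y'))
          - complex_of_real (stack x' y' \<bullet> (S *v stack x' y'))))"
      using state by (intro weyl_conjugation[OF weyl_unitary T char]) (auto simp: state_def positive_op_def)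
    moreover have "cdot (cvec x y) (cvec x' y') - cdot (cvec x' y') (cvec x y)
        - \<i> * complex_of_real (sqrt 2 * (stack l m' \<bullet> stack x' y'))
      = - \<i> * complex_of_real (sqrt 2 * (stack (l + sqrt 2 *\<^sub>R y) (m' - sqrt 2 *\<^sub>R x) \<bullet> stack x' y'))"
    proof -
      have "2 * (x \<bullet> y' - y \<bullet> x') - sqrt 2 * (l \<bullet> x' + m' \<bullet> y')
          = - (sqrt 2 * ((l + sqrt 2 *\<^sub>R y) \<bullet> x' + (m' - sqrt 2 *\<^sub>R x) \<bullet> y'))"
        by (simp add: inner_add_left inner_diff_left algebra_simps)
      then show ?thesis
        unfolding cdot_cvec_diff inner_stack by (simp add: complex_eq_iff)
    qed
    ultimately show "has_op_trace (conjugate_op ?U \<rho> \<circ> weyl (cvec x' y'))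
      (exp (- \<i> * complex_of_real (sqrt 2 * (stack (l + sqrt 2 *\<^sub>R y) (m' - sqrt 2 *\<^sub>R x) \<bullet> stack x' y'))
          - complex_of_real (stack x' y' \<bullet> (S *v stack x' y'))))"
      by (simp add: exp_add[symmetric] add_diff_eq)
  qed
qed

text \<open>Since J^2 = -1, the defining relation makes - J L^T J a left inverse of
  \<open>L\<close>.\<close>

lemma Sp_invertible:
  fixes L :: "real ^ ('n::finite + 'n) ^ ('n + 'n)"
  assumes "L \<in> Sp"
  shows "invertible L"
proof -
  let ?J = "J_mat :: real ^ ('n + 'n) ^ ('n + 'n)"
  have "?J ** ?J = - mat 1"
  proof (unfold vec_eq_iff, intro allI)
    fix i j
    show "(?J ** ?J) $ i $ j = (- mat 1 :: real ^ ('n + 'n) ^ ('n + 'n)) $ i $ j"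
      by (cases i; cases j)
         (simp_all add: matrix_matrix_mult_def J_mat_def mat_def sum_UNIV_sum
           if_distrib[of "\<lambda>z. z * _"] if_distrib[of "\<lambda>z. _ * z"] cong: if_cong)
  qed
  moreover have "transpose L ** ?J ** L = ?J" using assms by (simp add: Sp_def)
  ultimately have "?J ** (transpose L ** ?J ** L) = - mat 1" by simp
  then have "(?J ** transpose L ** ?J) ** L = - mat 1" by (simp only: matrix_mul_assoc)
  moreover have "(- A) ** L = - (A ** L)" for A :: "real ^ ('n + 'n) ^ ('n + 'n)"
    by (simp add: vec_eq_iff matrix_matrix_mult_def sum_negf)
  ultimately have "(- (?J ** transpose L ** ?J)) ** L = mat 1" by simp
  then show ?thesis using invertible_left_inverse by blast
qed

text \<open>Conjugating W(z) by the inverse of \<open>G\<close> gives W(L^-1 z). Substituting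
  \<open>K\<close> z into the linear and quadratic forms transposes \<open>K\<close> onto
  \<open>w\<close> and \<open>S\<close>.\<close>

lemma gaussian_characteristic_Gamma:
  assumes "gaussian_characteristic \<rho> w S" and L: "L \<in> Sp" and G: "is_Gamma L G"
  defines "K \<equiv> matrix_inv L"
  shows "gaussian_characteristic (conjugate_op G \<rho>) (transpose K *v w) (transpose K ** S ** K)"
proof -
  interpret gaussian_characteristic \<rho> w S by fact
  have U: "unitary_op G" using G by (simp add: is_Gamma_def)
  have LK: "L ** K = mat 1"
    using someI_ex[OF Sp_invertible[OF L, unfolded invertible_def]]
    unfolding K_def matrix_inv_def by blast
  show ?thesis
  proof
    show "state (conjugate_op G \<rho>)" by (rule state_conjugate[OF U state])
    fix x y
    define v where "v = K *v stack x y"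
    have "L *v v = stack x y" by (simp add: v_def matrix_vector_mul_assoc LK)
    then have "G \<circ> weyl (cvec (upper v) (lower v)) \<circ> inv G = weyl (cvec (upper (stack x y)) (lower (stack x y)))"
      using G by (simp add: is_Gamma_def stack_upper_lower)
    moreover have "upper (stack x y) = x" "lower (stack x y) = y"
      by (simp_all add: vec_eq_iff upper_def lower_def stack_def)
    ultimately have conj: "G (weyl (cvec (upper v) (lower v)) (inv G f)) = weyl (cvec x y) f" for f
      by (metis comp_apply)
    have T: "inv G \<circ> weyl (cvec x y) \<circ> G = (\<lambda>f. 1 *\<^sub>C weyl (cvec (upper v) (lower v)) f)"
      by (rule ext) (simp add: conj[symmetric] unitary_op_inv_left[OF U])
    have "has_op_trace (conjugate_op G \<rho> \<circ> weyl (cvec x y))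
      (1 * exp (- \<i> * complex_of_real (sqrt 2 * (w \<bullet> stack (upper v) (lower v)))
          - complex_of_real (stack (upper v) (lower v) \<bullet> (S *v stack (upper v) (lower v)))))"
      using state by (intro weyl_conjugation[OF U T char]) (auto simp: state_def positive_op_def)
    moreover have "w \<bullet> v = (transpose K *v w) \<bullet> stack x y"
      unfolding v_def by (metis dot_lmul_matrix transpose_matrix_vector)
    moreover have "v \<bullet> (S *v v) = stack x y \<bullet> ((transpose K ** S ** K) *v stack x y)"
      unfolding v_def matrix_vector_mul_assoc[symmetric]
      by (metis dot_lmul_matrix transpose_matrix_vector inner_commute)
    ultimately show "has_op_trace (conjugate_op G \<rho> \<circ> weyl (cvec x y))
      (exp (- \<i> * complex_of_real (sqrt 2 * ((transpose K *v w) \<bullet> stack x y))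
          - complex_of_real (stack x y \<bullet> ((transpose K ** S ** K) *v stack x y))))"
      by (simp add: stack_upper_lower)
  qed
qed

lemma gaussian_characteristic_number:
  fixes \<rho> :: "'n::finite fock \<Rightarrow> 'n fock"
  assumes "gaussian_characteristic (conjugate_op V \<rho>) w S" "unitary_op V" "state \<rho>"
  shows "summable (number_term \<rho> V)"
    and "number_expectation \<rho> V = complex_of_real ((trace S - CARD('n) + w \<bullet> w) / 2)"
  using gaussian_characteristic.number_term_sums[OF assms(1)]
  unfolding number_expectation_def number_term_conjugate[OF assms(2,3)]
  by (auto simp: sums_iff)

theorem theorem4p1:
  fixes l m :: "real ^ 'n"
    and S :: "real ^ ('n + 'n) ^ ('n + 'n)"
    and \<rho> :: "'n::finite fock \<Rightarrow> 'n fock"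
  assumes "gaussian_state l m S \<rho>"
  shows "summable (number_term \<rho> id) \<and>
    (\<forall>x y :: real ^ 'n.
       summable (number_term \<rho> (weyl (cvec x y))) \<and>
       number_expectation \<rho> (weyl (cvec x y)) - number_expectation \<rho> id
         = complex_of_real ((norm x)\<^sup>2 + (norm y)\<^sup>2 + sqrt 2 * (y \<bullet> l + x \<bullet> m))) \<and>
    (\<forall>L \<in> Sp. \<forall>G. is_Gamma L G \<longrightarrow>
       summable (number_term \<rho> G) \<and>
       number_expectation \<rho> G - number_expectation \<rho> id
         = complex_of_real (1 / 2 *
             (trace (S ** (matrix_inv L ** transpose (matrix_inv L) - mat 1)) +
              stack l (- m) \<bullet>
                ((matrix_inv L ** transpose (matrix_inv L) - mat 1) *v stack l (- m)))))"
proof -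
  let ?w = "stack l (- m)"
  have state: "state \<rho>" using assms by (simp add: gaussian_state_def)
  have gauss: "gaussian_characteristic \<rho> ?w S"
    using assms by unfold_locales (simp_all add: gaussian_state_def inner_stack)
  then have "gaussian_characteristic (conjugate_op id \<rho>) ?w S"
    by (simp add: conjugate_op_def)
  note id = gaussian_characteristic_number[OF this unitary_op_id state]
  have "summable (number_term \<rho> (weyl (cvec x y))) \<and>
       number_expectation \<rho> (weyl (cvec x y)) - number_expectation \<rho> id
         = complex_of_real ((norm x)\<^sup>2 + (norm y)\<^sup>2 + sqrt 2 * (y \<bullet> l + x \<bullet> m))" for x y
  proof -
    note num = gaussian_characteristic_number[OF gaussian_characteristic_weyl[OF gauss] weyl_unitary state, of x y]
    \<comment> \<open>A displacement leaves the trace of \<open>S\<close> and the vacuum constant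
      alone, so only the squared length of the mean changes.\<close>
    have "stack (l + sqrt 2 *\<^sub>R y) (- m - sqrt 2 *\<^sub>R x) \<bullet> stack (l + sqrt 2 *\<^sub>R y) (- m - sqrt 2 *\<^sub>R x) - ?w \<bullet> ?w
        = 2 * ((norm x)\<^sup>2 + (norm y)\<^sup>2 + sqrt 2 * (y \<bullet> l + x \<bullet> m))"
      unfolding inner_stack power2_norm_eq_inner
      by (simp add: inner_add_left inner_add_right inner_diff_left inner_diff_right inner_commute algebra_simps)
    moreover have "(c + a) / 2 - (c + b) / 2 = d" if "a - b = 2 * d" for a b c d :: real
      using that by (simp add: field_simps)
    ultimately show ?thesis
      unfolding num(2) id(2) of_real_diff[symmetric] of_real_eq_iff using num(1) by blast
  qed
  moreover have "summable (number_term \<rho> G) \<and>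
       number_expectation \<rho> G - number_expectation \<rho> id
         = complex_of_real (1 / 2 *
             (trace (S ** (matrix_inv L ** transpose (matrix_inv L) - mat 1)) +
              ?w \<bullet> ((matrix_inv L ** transpose (matrix_inv L) - mat 1) *v ?w)))"
    if L: "L \<in> Sp" and G: "is_Gamma L G" for L G
  proof -
    let ?K = "matrix_inv L"
    have "unitary_op G" using G by (simp add: is_Gamma_def)
    note num = gaussian_characteristic_number[OF gaussian_characteristic_Gamma[OF gauss L G] this state]
    \<comment> \<open>Cyclicity of the matrix trace gathers the factors on one side of
      \<open>S\<close>; transposition does the same for the mean. The vacuum constant
      cancels.\<close>
    have 1: "trace (transpose ?K ** S ** ?K) = trace (S ** (?K ** transpose ?K))"
      by (metis matrix_mul_assoc trace_mul_sym)
    have 2: "(transpose ?K *v ?w) \<bullet> (transpose ?K *v ?w) = ?w \<bullet> ((?K ** transpose ?K) *v ?w)"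
      by (simp add: transpose_matrix_vector dot_lmul_matrix flip: matrix_vector_mul_assoc)
    have 3: "S ** (M - mat 1) = S ** M - S" for M
      by (simp add: vec_eq_iff matrix_matrix_mult_def mat_def right_diff_distrib sum_subtractf
          if_distrib[of "\<lambda>z. _ * z"] cong: if_cong)
    show ?thesis
      unfolding num(2) id(2) 1 2 3 trace_sub matrix_vector_mult_diff_rdistrib matrix_vector_mul_lid
        inner_diff_right of_real_diff[symmetric] of_real_eq_iff
      using num(1) by (simp add: field_simps)
  qed
  ultimately show ?thesis using id(1) by blast
qed

end
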